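(* Let $\Bbbk$ be a field of characteristic $p>0$, let $\ell=(\ell_1,\ldots,\ell_n)$, where the $\ell_i$ are pairwise prime linear forms in $\Bbbk[x,y]$, and let $\mathfrak{b}=\langle U,V\rangle$, where $U$ and $V$ are relatively prime non-constant forms in $\Bbbk[x,y]$. Fix $\mathbf{t}\in\mathbb{R}_{>0}^n$ and set $\lambda=\deg(UV)/\|\mathbf{t}\|$. If, for some integer $e\ge 0$, the truncation $\langle\lambda\mathbf{t}\rangle_e$ lies in the upper region $\mathcal{U}$ attached to $\ell$ and $\mathfrak{b}$, then there exists a unique critical point $\mathbf{c}\le\langle\lambda\mathbf{t}\rangle_e$ associated with $\ell$ and $\mathfrak{b}$ with coordinates in $\mathbb{Q}_{p^e}$, and $\operatorname{ft}^{\mathfrak{b}}(\ell^{\mathbf{t}})$ is determined by $\mathbf{c}$: $$\operatorname{ft}^{\mathfrak{b}}(\ell^{\mathbf{t}})=\max\left\{\frac{c_1}{t_1},\ldots,\frac{c_n}{t_n}\right\}<\lambda.$$ Otherwise (that is, if $\langle\lambda\mathbf{t}\rangle_e\notin\mathcal{U}$ for every $e\geq 0$), $$\operatorname{ft}^{\mathfrak{b}}(\ell^{\mathbf{t}})=\lambda=\frac{\deg(UV)}{\|\mathbf{t}\|}.$$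
   Context: A form is a nonzero homogeneous polynomial of $R=\Bbbk[x,y]$ (standard grading); $q$ denotes a power $p^e$, $e\ge 0$. $\mathbb{Q}_{q}=\{a/q:a\in\mathbb{Z}\}$. $\|\mathbf{t}\|=\sum_i|t_i|$; $\mathbf{u}\le\mathbf{v}$ means $u_i\le v_i$ for all $i$. For $\lambda>0$ and integer $e\ge0$, $\langle\lambda\rangle_e=(\lceil\lambda p^e\rceil-1)/p^e$, applied componentwise to vectors. $\ell^{\mathbf{a}}=\ell_1^{a_1}\cdots\ell_n^{a_n}$ for $\mathbf{a}\in\mathbb{N}^n$. For an ideal $\mathfrak{a}$ of $R$, $\deg\mathfrak{a}=\dim_{\Bbbk}R/\mathfrak{a}$. For forms $F,G,H\in R$ with no common non-constant factor there is an exact sequence of graded modules $0\to R(-m)\oplus R(-n')\to R(-\deg F)\oplus R(-\deg G)\oplus R(-\deg H)\to R\to R/\langle F,G,H\rangle\to0$; the syzygy gap is $\delta(F,G,H)=|m-n'|$. $\Delta:\mathbb{R}_{\ge0}^n\to\mathbb{R}$ is the unique continuous function with $\Delta(\mathbf{a}/q)=\frac1q\,\delta(U^q,V^q,\ell^{\mathbf{a}})$, and $\Phi:\mathbb{R}_{\ge0}^n\to\mathbb{R}$ is the unique continuous function with $\Phi(\mathbf{a}/q)=\frac1{q^2}\deg\langle U^q,V^q,\ell^{\mathbf{a}}\rangle$, for all $q$ and all $\mathbf{a}\in\mathbb{N}^n$ (both exist and depend only on $\ell$ and $\mathfrak{b}$). The upper region is $\mathcal{U}=\{\mathbf{t}\in\mathbb{R}_{\ge0}^n:\Phi(\mathbf{t})=\deg\mathfrak{b}\}$.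 A point $\mathbf{c}\in\mathbb{R}_{\ge0}^n$ is a critical point associated with $\ell$ and $\mathfrak{b}$ if $\Delta$ attains a local maximum at $\mathbf{c}$ (as a function on $\mathbb{R}^n_{\ge 0}$) and $\Delta(\mathbf{c})=\deg(UV)-\|\mathbf{c}\|$. The $F$-threshold function is $\operatorname{ft}^{\mathfrak{b}}(\ell^{\mathbf{t}})=\min\{\lambda\in\mathbb{R}_{>0}:\lambda\mathbf{t}\in\mathcal{U}\}$ for $\mathbf{t}\in\mathbb{R}_{>0}^n$ (the minimum exists). *)

theory Defs
  imports "HOL-Analysis.Analysis" "HOL-Computational_Algebra.Computational_Algebra"
begin

text \<open>The ring \<open>k[x,y]\<close> is \<open>k[x][y]\<close>, so \<open>coeff (coeff F j) i\<close> is the coefficient of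
  \<open>x\<^sup>i y\<^sup>j\<close> in \<open>F\<close>, and a scalar \<open>c\<close> acts as \<open>smult [:c:]\<close>.\<close>

text \<open>Degrees range over all integers because of the shifts \<open>R(-m)\<close> in graded resolutions:
  only \<open>0\<close> is homogeneous of negative degree, and \<open>0\<close> is homogeneous of every degree.\<close>

definition homogeneous :: "int \<Rightarrow> 'k::zero poly poly \<Rightarrow> bool" where
  "homogeneous d F \<longleftrightarrow> (\<forall>i j. coeff (coeff F j) i \<noteq> 0 \<longrightarrow> int i + int j = d)"

definition is_form :: "'k::zero poly poly \<Rightarrow> bool" where
  "is_form F \<longleftrightarrow> F \<noteq> 0 \<and> (\<exists>d. homogeneous d F)"

text \<open>The total degree; meaningful for \<open>F \<noteq> 0\<close> only.\<close>

definition tdeg :: "'k::zero poly poly \<Rightarrow> nat" where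
  "tdeg F = Max {i + j |i j. coeff (coeff F j) i \<noteq> 0}"

text \<open>\<open>R\<close> is regarded as a module over itself, whose submodules are the ideals.\<close>

definition ideal_gen :: "'a::comm_ring_1 set \<Rightarrow> 'a set" where
  "ideal_gen S = module.span (*) S"

text \<open>The residue classes of the elements of the finite set \<open>B\<close> are distinct and form a
  basis of the vector space \<open>R/I\<close> over \<open>k\<close>.\<close>

definition quotient_basis :: "'k::field poly poly set \<Rightarrow> 'k poly poly set \<Rightarrow> bool" where
  "quotient_basis I B \<longleftrightarrow> finite B \<and>
     (\<forall>c :: 'k poly poly \<Rightarrow> 'k. (\<Sum>b\<in>B. smult [:c b:] b) \<in> I \<longrightarrow> (\<forall>b\<in>B. c b = 0)) \<and>
     (\<forall>f. \<exists>c :: 'k poly poly \<Rightarrow> 'k. f - (\<Sum>b\<in>B. smult [:c b:] b) \<in> I)"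

text \<open>\<open>dim\<^sub>k R/I\<close>, for ideals \<open>I\<close> of finite colength.\<close>

definition ideal_deg :: "'k::field poly poly set \<Rightarrow> nat" where
  "ideal_deg I = (THE d. \<exists>B. quotient_basis I B \<and> card B = d)"

text \<open>Exactness of
  \<open>0 \<rightarrow> R(-m) \<oplus> R(-m') \<rightarrow> R(-deg F) \<oplus> R(-deg G) \<oplus> R(-deg H) \<rightarrow> R \<rightarrow> R/\<langle>F,G,H\<rangle> \<rightarrow> 0\<close>,
  where \<open>(A1,B1,C1)\<close> and \<open>(A2,B2,C2)\<close> are the images of the two free generators. The third
  map is \<open>(A,B,C) \<mapsto> A F + B G + C H\<close>, so exactness at \<open>R\<close> and at \<open>R/\<langle>F,G,H\<rangle>\<close> is automatic.\<close>

definition syzygy_resolution ::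
    "int \<Rightarrow> int \<Rightarrow> 'k::field poly poly \<Rightarrow> 'k poly poly \<Rightarrow> 'k poly poly \<Rightarrow> bool" where
  "syzygy_resolution m m' F G H \<longleftrightarrow> (\<exists>A1 B1 C1 A2 B2 C2.
     homogeneous (m - int (tdeg F)) A1 \<and> homogeneous (m' - int (tdeg F)) A2 \<and>
     homogeneous (m - int (tdeg G)) B1 \<and> homogeneous (m' - int (tdeg G)) B2 \<and>
     homogeneous (m - int (tdeg H)) C1 \<and> homogeneous (m' - int (tdeg H)) C2 \<and>
     (\<forall>A B C. A * F + B * G + C * H = 0 \<longleftrightarrow>
        (\<exists>P Q. A = P * A1 + Q * A2 \<and> B = P * B1 + Q * B2 \<and> C = P * C1 + Q * C2)) \<and>
     (\<forall>P Q. P * A1 + Q * A2 = 0 \<and> P * B1 + Q * B2 = 0 \<and> P * C1 + Q * C2 = 0 \<longrightarrow>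
        P = 0 \<and> Q = 0))"

definition syzygy_gap :: "'k::field poly poly \<Rightarrow> 'k poly poly \<Rightarrow> 'k poly poly \<Rightarrow> int" where
  "syzygy_gap F G H = (THE d. \<exists>m m'. syzygy_resolution m m' F G H \<and> d = \<bar>m - m'\<bar>)"

definition orthant :: "(real ^ 'n) set" where
  "orthant = {t. \<forall>i. 0 \<le> t $ i}"

definition l1norm :: "real ^ 'n \<Rightarrow> real" where
  "l1norm t = (\<Sum>i\<in>UNIV. \<bar>t $ i\<bar>)"

definition form_power :: "('n::finite \<Rightarrow> 'k::field poly poly) \<Rightarrow> ('n \<Rightarrow> nat) \<Rightarrow> 'k poly poly" where
  "form_power l a = (\<Prod>i\<in>UNIV. l i ^ a i)"

text \<open>In the next two definitions the conditions determine the chosen function on the orthant;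
  its values elsewhere are arbitrary and are never used.\<close>

definition Delta :: "('n::finite \<Rightarrow> 'k::field poly poly) \<Rightarrow> 'k poly poly \<Rightarrow> 'k poly poly
    \<Rightarrow> real ^ 'n \<Rightarrow> real" where
  "Delta l U V = (SOME D. continuous_on orthant D \<and>
     (\<forall>e (a :: 'n \<Rightarrow> nat). let q = CHAR('k) ^ e in
        D (\<chi> i. real (a i) / real q) =
          real_of_int (syzygy_gap (U ^ q) (V ^ q) (form_power l a)) / real q))"

definition Phi :: "('n::finite \<Rightarrow> 'k::field poly poly) \<Rightarrow> 'k poly poly \<Rightarrow> 'k poly poly
    \<Rightarrow> real ^ 'n \<Rightarrow> real" where
  "Phi l U V = (SOME D. continuous_on orthant D \<and>
     (\<forall>e (a :: 'n \<Rightarrow> nat). let q = CHAR('k) ^ e in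
        D (\<chi> i. real (a i) / real q) =
          real (ideal_deg (ideal_gen {U ^ q, V ^ q, form_power l a})) / (real q)\<^sup>2))"

definition upper_region :: "('n::finite \<Rightarrow> 'k::field poly poly) \<Rightarrow> 'k poly poly \<Rightarrow> 'k poly poly
    \<Rightarrow> (real ^ 'n) set" where
  "upper_region l U V = {t \<in> orthant. Phi l U V t = real (ideal_deg (ideal_gen {U, V}))}"

definition critical_point :: "('n::finite \<Rightarrow> 'k::field poly poly) \<Rightarrow> 'k poly poly \<Rightarrow> 'k poly poly
    \<Rightarrow> real ^ 'n \<Rightarrow> bool" where
  "critical_point l U V c \<longleftrightarrow> c \<in> orthant \<and>
     (\<exists>\<epsilon>>0. \<forall>s \<in> orthant \<inter> ball c \<epsilon>. Delta l U V s \<le> Delta l U V c) \<and>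
     Delta l U V c = real (tdeg (U * V)) - l1norm c"

definition F_threshold :: "('n::finite \<Rightarrow> 'k::field poly poly) \<Rightarrow> 'k poly poly \<Rightarrow> 'k poly poly
    \<Rightarrow> real ^ 'n \<Rightarrow> real" where
  "F_threshold l U V t = (LEAST r. 0 < r \<and> r *\<^sub>R t \<in> upper_region l U V)"

definition truncation :: "nat \<Rightarrow> nat \<Rightarrow> real ^ 'n \<Rightarrow> real ^ 'n" where
  "truncation p e t = (\<chi> i. (of_int \<lceil>t $ i * real p ^ e\<rceil> - 1) / real p ^ e)"

definition fractions :: "nat \<Rightarrow> real set" where
  "fractions q = {of_int a / real q |a :: int. True}"

end

theory Submission
  imports Defs
begin

text \<open>Write \<open>d = deg (U V)\<close>. The gap of three forms \<open>F\<close>, \<open>G\<close>, \<open>H\<close> is \<open>deg (F G H) - 2 e\<close>,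
  where \<open>e\<close> is the least degree of a nonzero syzygy. Multiplying \<open>H\<close> by a linear form
  changes the two degrees of a resolution in exactly one place, by one
  (\<open>syzygy_degrees_mult_line\<close>), and Frobenius multiplies them by \<open>q\<close> (\<open>gap_frobenius\<close>). So
  the normalized gap is 1-Lipschitz for the \<open>L\<^sup>1\<close>-norm and \<open>\<Delta>\<close> exists. The same induction
  computes the colength of \<open>\<langle>F, G, H\<rangle>\<close>, hence \<open>\<Phi> = deg \<langle>U, V\<rangle> + (\<Delta>\<^sup>2 - (d - \<parallel>t\<parallel>)\<^sup>2)/4\<close>
  (\<open>Phi_eq\<close>), and the upper region is where \<open>\<Delta>(t)\<close> attains its upper bound \<open>\<bar>d - \<parallel>t\<parallel>\<bar>\<close>.

  For a grid point \<open>a/q\<close> with \<open>\<parallel>a/q\<parallel> < d\<close> this means \<open>l\<^sup>a \<in> \<langle>U\<^sup>q, V\<^sup>q\<rangle>\<close>. Let \<open>b \<le> a\<close> be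
  minimal with \<open>l\<^sup>b = A U\<^sup>q + B V\<^sup>q\<close>, and put \<open>c = b/q\<close>. By minimality no \<open>l\<^sub>i\<close> with \<open>b\<^sub>i >
  0\<close> divides both \<open>A\<close> and \<open>B\<close>. Comparing an arbitrary syzygy at a higher Frobenius level
  with the power of \<open>(A, B, -1)\<close> then yields \<open>\<Delta>(s) \<le> \<bar>d - \<parallel>c\<parallel> - \<parallel>s - c\<parallel>\<bar>\<close> on the whole
  orthant (\<open>gap_le_near_minimal_exponent\<close>, \<open>exists_apex\<close>).

  The rest is elementary geometry. The bound makes \<open>c\<close> a local maximum, and it shows that
  every point \<open>s\<close> of the upper region below a common upper bound \<open>w \<ge> c\<close> with \<open>\<parallel>w\<parallel> < d\<close>
  satisfies \<open>c \<le> s\<close> (\<open>apex_le_upper\<close>). For \<open>w\<close> the truncation of \<open>\<lambda> t\<close>, any critical point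
  below \<open>w\<close> is thus above \<open>c\<close>, and equal to \<open>c\<close> by local maximality; and \<open>x t\<close> with \<open>x < \<lambda>\<close>
  lies in the upper region exactly when \<open>c \<le> x t\<close>, which gives the threshold. If no
  truncation lies in the upper region, then neither does any \<open>x t\<close> with \<open>x < \<lambda>\<close>, as it lies
  below some truncation, while \<open>\<lambda> t\<close> does because \<open>\<Delta>\<close> vanishes there.\<close>

section \<open>Homogeneous polynomials in two variables\<close>

lemma homogeneousD: "homogeneous d F \<Longrightarrow> coeff (coeff F j) i \<noteq> 0 \<Longrightarrow> int i + int j = d"
  by (auto simp: homogeneous_def)

lemma homogeneous_0 [simp]: "homogeneous d 0"
  by (auto simp: homogeneous_def)

lemma homogeneous_add: "homogeneous d F \<Longrightarrow> homogeneous d G \<Longrightarrow> homogeneous d (F + G)"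
  for F G :: "'k::field poly poly"
  unfolding homogeneous_def by (metis add.right_neutral coeff_add)

lemma homogeneous_uminus: "homogeneous d F \<Longrightarrow> homogeneous d (- F)"
  for F :: "'k::field poly poly"
  by (auto simp: homogeneous_def)

lemma homogeneous_diff: "homogeneous d F \<Longrightarrow> homogeneous d G \<Longrightarrow> homogeneous d (F - G)"
  for F G :: "'k::field poly poly"
  using homogeneous_add[OF _ homogeneous_uminus, of d F G] by simp

lemma coeff_coeff_mult:
  "coeff (coeff (F * G) j) i =
     (\<Sum>s\<le>j. \<Sum>r\<le>i. coeff (coeff F s) r * coeff (coeff G (j - s)) (i - r))"
  for F G :: "'k::field poly poly"
  by (simp add: coeff_mult coeff_sum)

lemma homogeneous_mult:
  fixes F G :: "'k::field poly poly"
  assumes "homogeneous a F" "homogeneous b G"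
  shows "homogeneous (a + b) (F * G)"
  unfolding homogeneous_def
proof (intro allI impI)
  fix i j assume "coeff (coeff (F * G) j) i \<noteq> 0"
  then obtain s where s: "s \<le> j"
    "(\<Sum>r\<le>i. coeff (coeff F s) r * coeff (coeff G (j - s)) (i - r)) \<noteq> 0"
    unfolding coeff_coeff_mult by (metis (no_types, lifting) atMost_iff sum.neutral)
  then obtain r where r: "r \<le> i" "coeff (coeff F s) r * coeff (coeff G (j - s)) (i - r) \<noteq> 0"
    by (metis (no_types, lifting) atMost_iff sum.neutral)
  have "int r + int s = a" "int (i - r) + int (j - s) = b"
    using r assms by (auto dest: homogeneousD)
  then show "int i + int j = a + b" using s r by auto
qed

lemma homogeneous_const [simp]: "homogeneous 0 [:[:c:]:]"
  by (auto simp: homogeneous_def coeff_pCons split: nat.splits)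

lemma homogeneous_1 [simp]: "homogeneous 0 (1 :: 'k::field poly poly)"
  using homogeneous_const[of "1::'k"] by (simp add: one_pCons)

lemma homogeneous_power: "homogeneous a F \<Longrightarrow> homogeneous (int n * a) (F ^ n)"
  for F :: "'k::field poly poly"
proof (induction n)
  case (Suc n)
  then have "homogeneous (a + int n * a) (F * F ^ n)" by (intro homogeneous_mult) auto
  then show ?case by (simp add: algebra_simps)
qed auto

lemma homogeneous_unique:
  assumes "homogeneous a F" "homogeneous b F" "F \<noteq> 0" shows "a = b"
proof -
  obtain j where "coeff F j \<noteq> 0" using assms(3) by (metis leading_coeff_0_iff)
  then obtain i where "coeff (coeff F j) i \<noteq> 0" by (metis leading_coeff_0_iff)
  then show ?thesis using assms homogeneousD by metis
qed

lemma homogeneous_negative: "homogeneous d F \<Longrightarrow> d < 0 \<Longrightarrow> F = 0"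
  by (rule poly_eqI, rule poly_eqI) (fastforce simp: homogeneous_def)

text \<open>For a nonzero homogeneous polynomial the set whose maximum is \<open>tdeg\<close> is a singleton,
  so the maximum is never taken over an infinite or empty set.\<close>

lemma tdeg_homogeneous:
  assumes "homogeneous d F" "F \<noteq> 0" shows "int (tdeg F) = d"
proof -
  obtain j where "coeff F j \<noteq> 0" using assms(2) by (metis leading_coeff_0_iff)
  then obtain i where ij: "coeff (coeff F j) i \<noteq> 0" by (metis leading_coeff_0_iff)
  have "{i + j |i j. coeff (coeff F j) i \<noteq> 0} = {nat d}"
    using ij homogeneousD[OF assms(1)] by (force simp flip: of_nat_add)
  then have "tdeg F = nat d" unfolding tdeg_def by simp
  then show ?thesis using homogeneousD[OF assms(1) ij] by simp
qed

lemma form_homogeneous: "is_form F \<Longrightarrow> homogeneous (int (tdeg F)) F"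
  using tdeg_homogeneous by (auto simp: is_form_def)

lemma form_nonzero: "is_form F \<Longrightarrow> F \<noteq> 0"
  by (simp add: is_form_def)

lemma is_form_mult: "is_form F \<Longrightarrow> is_form G \<Longrightarrow> is_form (F * G)"
  for F G :: "'k::field poly poly"
  unfolding is_form_def using homogeneous_mult by (metis mult_eq_0_iff)

lemma is_form_1 [simp]: "is_form (1 :: 'k::field poly poly)"
  unfolding is_form_def using homogeneous_1 by (metis one_neq_zero)

lemma is_form_power: "is_form F \<Longrightarrow> is_form (F ^ n)"
  for F :: "'k::field poly poly"
  unfolding is_form_def using homogeneous_power by (metis power_eq_0_iff)

lemma tdeg_mult: "is_form F \<Longrightarrow> is_form G \<Longrightarrow> tdeg (F * G) = tdeg F + tdeg G"
  for F G :: "'k::field poly poly"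
  using tdeg_homogeneous[OF homogeneous_mult[OF form_homogeneous form_homogeneous], of F G]
  by (simp add: is_form_def)

lemma tdeg_1 [simp]: "tdeg (1 :: 'k::field poly poly) = 0"
  using tdeg_homogeneous[OF homogeneous_1] by simp

lemma tdeg_power: "is_form F \<Longrightarrow> tdeg (F ^ n) = n * tdeg F"
  for F :: "'k::field poly poly"
  by (induction n) (simp_all add: tdeg_mult is_form_power)

lemma homogeneous_0_const: "homogeneous 0 F \<Longrightarrow> \<exists>c. F = [:[:c:]:]"
proof -
  assume F: "homogeneous 0 F"
  have "F = [:[:coeff (coeff F 0) 0:]:]"
    by (rule poly_eqI, rule poly_eqI)
       (use F in \<open>fastforce simp: homogeneous_def coeff_pCons split: nat.splits\<close>)
  then show ?thesis by blast
qed

lemma is_unit_poly_poly: "is_unit F \<Longrightarrow> \<exists>c \<noteq> 0. F = [:[:c:]:]"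
  for F :: "'k::field poly poly"
  by (metis is_unit_poly_iff dvd_0_left_iff one_neq_zero pCons_eq_0_iff)

abbreviation X\<^sub>R :: "'k::field poly poly" where "X\<^sub>R \<equiv> [:[:0, 1:]:]"
abbreviation Y\<^sub>R :: "'k::field poly poly" where "Y\<^sub>R \<equiv> [:0, 1:]"

lemma homogeneous_X: "homogeneous 1 X\<^sub>R"
  by (auto simp: homogeneous_def coeff_pCons split: nat.splits)

lemma homogeneous_Y: "homogeneous 1 Y\<^sub>R"
  by (auto simp: homogeneous_def coeff_pCons one_pCons split: nat.splits if_splits)

lemma monom_monom: "monom (monom c i) j = [:[:c:]:] * X\<^sub>R ^ i * Y\<^sub>R ^ j"
proof -
  have *: "[:[:0, 1:]:] ^ i = [:[:0, 1:] ^ i:]" for i :: nat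
    by (induction i) (auto simp: one_pCons)
  show ?thesis by (simp add: monom_altdef *)
qed

text \<open>The homogeneous component of degree \<open>d\<close>. It separates the degrees in an identity
  between polynomials that are not assumed to be homogeneous, as in the exactness condition
  for syzygies.\<close>

definition hcomp :: "int \<Rightarrow> 'k::field poly poly \<Rightarrow> 'k poly poly" where
  "hcomp d F =
     (if d < 0 then 0
      else (\<Sum>j\<le>nat d. monom (monom (coeff (coeff F j) (nat d - j)) (nat d - j)) j))"

lemma coeff_hcomp:
  "coeff (coeff (hcomp d F) j) i = (if int i + int j = d then coeff (coeff F j) i else 0)"
proof (cases "d < 0")
  case False
  have "coeff (coeff (hcomp d F) j) i =
      (\<Sum>s\<le>nat d. if s = j then if nat d - s = i then coeff (coeff F s) (nat d - s) else 0 else 0)"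
    using False by (auto simp: hcomp_def coeff_sum intro!: sum.cong)
  also have "\<dots> = (if j \<le> nat d then if nat d - j = i then coeff (coeff F j) i else 0 else 0)"
    by (subst sum.delta) auto
  finally show ?thesis using False by auto
qed (auto simp: hcomp_def)

lemma hcomp_negative: "d < 0 \<Longrightarrow> hcomp d F = 0"
  by (simp add: hcomp_def)

lemma hcomp_homogeneous: "homogeneous d F \<Longrightarrow> hcomp d F = F"
  by (rule poly_eqI, rule poly_eqI) (auto simp: coeff_hcomp dest: homogeneousD)

lemma hcomp_add: "hcomp d (F + G) = hcomp d F + hcomp d G"
  by (rule poly_eqI, rule poly_eqI) (auto simp: coeff_hcomp)

lemma hcomp_mult:
  assumes "homogeneous a A" shows "hcomp d (P * A) = hcomp (d - a) P * A"
proof (rule poly_eqI, rule poly_eqI)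
  fix j i
  have "(if int i + int j = d then coeff (coeff P s) r * coeff (coeff A (j - s)) (i - r) else 0)
      = coeff (coeff (hcomp (d - a) P) s) r * coeff (coeff A (j - s)) (i - r)"
    if "s \<le> j" "r \<le> i" for s r
  proof (cases "coeff (coeff A (j - s)) (i - r) = 0")
    case False
    then have "int (i - r) + int (j - s) = a" using homogeneousD[OF assms] by blast
    then show ?thesis using that by (auto simp: coeff_hcomp)
  qed auto
  then show "coeff (coeff (hcomp d (P * A)) j) i = coeff (coeff (hcomp (d - a) P * A) j) i"
    unfolding coeff_hcomp[of d "P * A"] coeff_coeff_mult
    by (cases "int i + int j = d") (auto intro!: sum.cong sum.neutral)
qed

lemma homogeneous_hcomp: "homogeneous d (hcomp d F)"
  by (auto simp: homogeneous_def coeff_hcomp split: if_splits)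

lemma homogeneous_divide:
  fixes A F :: "'k::field poly poly"
  assumes "homogeneous a A" "A \<noteq> 0" "homogeneous d (F * A)" shows "homogeneous (d - a) F"
proof -
  have "hcomp (d - a) F * A = F * A"
    using hcomp_homogeneous[OF assms(3)] hcomp_mult[OF assms(1), of d F] by simp
  then have "F = hcomp (d - a) F" using assms(2) by simp
  then show ?thesis using homogeneous_hcomp by metis
qed

lemma homogeneous_expansion:
  assumes "homogeneous (int d) F"
  shows "F = (\<Sum>j\<le>d. [:[:coeff (coeff F j) (d - j):]:] * X\<^sub>R ^ (d - j) * Y\<^sub>R ^ j)"
  using hcomp_homogeneous[OF assms] by (simp add: hcomp_def monom_monom)

section \<open>Restriction to the zero line of a linear form\<close>

text \<open>Restricting a polynomial to the line \<open>l = 0\<close>, parametrized by \<open>t\<close>, gives a surjection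
  \<open>k[x,y] \<rightarrow> k[t]\<close> with kernel \<open>(l)\<close> that sends forms of degree \<open>d\<close> to multiples of \<open>t\<^sup>d\<close>. It
  shows that \<open>l\<close> is prime and that two forms can be made congruent modulo \<open>l\<close> by scaling the
  one of smaller degree with a power of \<open>z\<close>, a linear form restricting to \<open>t\<close>.\<close>

locale line_restriction =
  fixes l :: "'k::field poly poly" and \<rho> :: "'k poly poly \<Rightarrow> 'k poly" and z :: "'k poly poly"
  assumes line_form: "is_form l" and line_tdeg: "tdeg l = 1"
    and rho_add: "\<rho> (F + G) = \<rho> F + \<rho> G"
    and rho_mult: "\<rho> (F * G) = \<rho> F * \<rho> G"
    and rho_const: "\<rho> [:[:c:]:] = [:c:]"
    and rho_eq_0_iff: "\<rho> F = 0 \<longleftrightarrow> l dvd F"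
    and rho_homogeneous: "homogeneous (int d) F \<Longrightarrow> \<exists>c. \<rho> F = monom c d"
    and z_homogeneous: "homogeneous 1 z"
    and rho_z: "\<rho> z = [:0, 1:]"

text \<open>If \<open>y\<close> occurs in \<open>l\<close>, the line is the graph \<open>y = c x\<close> and restriction is evaluation of
  a polynomial in \<open>y\<close> over \<open>k[x]\<close>. Otherwise the line is \<open>x = 0\<close> and restriction reads off
  the constant terms of the coefficients in \<open>k[x]\<close>.\<close>

lemma line_restriction_exists:
  fixes l :: "'k::field poly poly"
  assumes l: "is_form l" "tdeg l = 1"
  shows "\<exists>\<rho> z. line_restriction l \<rho> z"
proof -
  define \<alpha> where "\<alpha> = coeff (coeff l 0) 1"
  define \<beta> where "\<beta> = coeff (coeff l 1) 0"
  have lin: "l = [:[:\<alpha>:]:] * X\<^sub>R + [:[:\<beta>:]:] * Y\<^sub>R"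
    using homogeneous_expansion[of 1 l] form_homogeneous[OF l(1)] l(2)
    by (simp add: \<alpha>_def \<beta>_def)
  have ab: "\<alpha> \<noteq> 0 \<or> \<beta> \<noteq> 0" using lin form_nonzero[OF l(1)] by auto
  \<comment> \<open>A ring homomorphism fixing constants sends forms of degree \<open>d\<close> to multiples of \<open>t\<^sup>d\<close>
    as soon as it does so for the two variables.\<close>
  have monom: "\<exists>c. \<rho> F = monom c d"
    if add: "\<And>F G. \<rho> (F + G) = \<rho> F + \<rho> G" and mult: "\<And>F G. \<rho> (F * G) = \<rho> F * \<rho> G"
      and const: "\<And>c. \<rho> [:[:c:]:] = [:c:]"
      and X: "\<rho> X\<^sub>R = monom cx 1" and Y: "\<rho> Y\<^sub>R = monom cy 1"
      and F: "homogeneous (int d) F"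
    for \<rho> :: "'k poly poly \<Rightarrow> 'k poly" and cx cy d F
  proof -
    have zero: "\<rho> 0 = 0" using add[of 0 0] by (metis add_cancel_right_right)
    have one: "\<rho> 1 = 1" using const[of 1] by (simp add: one_pCons)
    have const': "\<rho> [:[:c:]:] = monom c 0" for c by (simp add: const monom_0)
    have pow: "\<rho> (G ^ n) = \<rho> G ^ n" for G n by (induction n) (auto simp: one mult)
    have sum: "\<rho> (\<Sum>j\<in>J. G j) = (\<Sum>j\<in>J. \<rho> (G j))" if "finite J" for G :: "nat \<Rightarrow> _" and J
      using that by (induction J) (auto simp: zero add)
    have "\<rho> F = \<rho> (\<Sum>j\<le>d. [:[:coeff (coeff F j) (d - j):]:] * X\<^sub>R ^ (d - j) * Y\<^sub>R ^ j)"
      using homogeneous_expansion[OF F] by simp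
    also have "\<dots> = (\<Sum>j\<le>d. monom (coeff (coeff F j) (d - j) * cx ^ (d - j) * cy ^ j) d)"
      unfolding sum[OF finite_atMost]
      by (intro sum.cong)
         (auto simp: mult pow const' X Y monom_power mult_monom
           simp del: mult_pCons_left)
    also have "\<dots> = monom (\<Sum>j\<le>d. coeff (coeff F j) (d - j) * cx ^ (d - j) * cy ^ j) d"
      by (simp add: monom_sum)
    finally show ?thesis by blast
  qed
  show ?thesis
  proof (cases "\<beta> = 0")
    case False
    define c where "c = [:0, - \<alpha> / \<beta>:]"
    have l': "l = [:[:\<beta>:]:] * [:- c, 1:]"
      using False by (simp add: lin c_def)
    have u: "is_unit [:[:\<beta>:]:]" using False by (simp add: is_unit_const_poly_iff dvd_field_iff)
    have "line_restriction l (\<lambda>F. poly F c) X\<^sub>R"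
    proof
      show "poly F c = 0 \<longleftrightarrow> l dvd F" for F
        unfolding l' poly_eq_0_iff_dvd by (rule mult_unit_dvd_iff'[OF u, symmetric])
      show "\<exists>a. poly F c = monom a d" if "homogeneous (int d) F" for d F
        by (rule monom[OF _ _ _ _ _ that, where cx = 1 and cy = "- \<alpha> / \<beta>"])
           (auto simp: c_def monom_altdef)
    qed (auto simp: homogeneous_X l)
    then show ?thesis by blast
  next
    case True
    have l': "l = [:[:\<alpha>:]:] * X\<^sub>R" using True lin by simp
    have a: "\<alpha> \<noteq> 0" using ab True by simp
    have u: "is_unit [:[:\<alpha>:]:]" using a by (simp add: is_unit_const_poly_iff dvd_field_iff)
    let ?\<rho> = "map_poly (\<lambda>c :: 'k poly. coeff c 0)"
    have cf: "coeff (?\<rho> F) n = coeff (coeff F n) 0" for F n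
      by (simp add: coeff_map_poly)
    have "line_restriction l ?\<rho> Y\<^sub>R"
    proof
      show add: "?\<rho> (F + G) = ?\<rho> F + ?\<rho> G" for F G
        by (rule poly_eqI) (simp add: cf)
      show mult: "?\<rho> (F * G) = ?\<rho> F * ?\<rho> G" for F G
        by (rule poly_eqI) (simp add: cf coeff_mult coeff_sum)
      show const: "?\<rho> [:[:c:]:] = [:c:]" for c
        by (rule poly_eqI) (auto simp: cf coeff_pCons split: nat.splits)
      show "?\<rho> F = 0 \<longleftrightarrow> l dvd F" for F
      proof -
        have "l dvd F \<longleftrightarrow> X\<^sub>R dvd F"
          unfolding l' by (rule mult_unit_dvd_iff'[OF u])
        also have "\<dots> \<longleftrightarrow> (\<forall>n. [:0, 1:] dvd coeff F n)"
          by (simp add: const_poly_dvd_iff)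
        also have "\<dots> \<longleftrightarrow> (\<forall>n. coeff (coeff F n) 0 = 0)"
        proof -
          have "[:0, 1:] dvd c \<longleftrightarrow> coeff c 0 = 0" for c :: "'k poly"
            using poly_eq_0_iff_dvd[of c 0] by (simp add: poly_0_coeff_0)
          then show ?thesis by simp
        qed
        finally show ?thesis by (simp add: poly_eq_iff cf)
      qed
      show Y: "?\<rho> Y\<^sub>R = [:0, 1:]"
        by (rule poly_eqI) (auto simp: cf coeff_pCons one_pCons split: nat.splits)
      have X: "?\<rho> X\<^sub>R = 0"
        by (rule poly_eqI) (auto simp: cf coeff_pCons split: nat.splits)
      show "\<exists>a. ?\<rho> F = monom a d" if "homogeneous (int d) F" for d F
        by (rule monom[OF add mult const _ _ that, where cx = 0 and cy = 1])
           (auto simp: Y X monom_altdef)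
    qed (auto simp: homogeneous_Y l)
    then show ?thesis by blast
  qed
qed

context line_restriction
begin

lemma rho_0 [simp]: "\<rho> 0 = 0"
  using rho_add[of 0 0] by (metis add_cancel_right_right)

lemma rho_1 [simp]: "\<rho> 1 = 1"
  using rho_const[of 1] by (simp add: one_pCons)

lemma rho_diff: "\<rho> (F - G) = \<rho> F - \<rho> G"
  using rho_add[of "F - G" G] by simp

lemma rho_power: "\<rho> (F ^ n) = \<rho> F ^ n"
  by (induction n) (auto simp: rho_mult)

lemma rho_sum: "finite J \<Longrightarrow> \<rho> (\<Sum>j\<in>J. G j) = (\<Sum>j\<in>J. \<rho> (G j))"
  by (induction J rule: finite_induct) (auto simp: rho_add)

lemma rho_z_sum:
  assumes "\<And>i. i \<ge> N \<Longrightarrow> coeff r i = 0"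
  shows "\<rho> (\<Sum>i<N. [:[:coeff r i:]:] * z ^ i) = r"
proof -
  have "\<rho> (\<Sum>i<N. [:[:coeff r i:]:] * z ^ i) = (\<Sum>i<N. monom (coeff r i) i)"
    by (simp add: rho_sum rho_mult rho_const rho_power rho_z del: mult_pCons_left)
       (simp add: monom_altdef)
  also have "\<dots> = r"
    by (rule poly_eqI) (use assms in \<open>auto simp: coeff_sum not_less\<close>)
  finally show ?thesis .
qed

lemma rho_surj: "\<exists>F. \<rho> F = r"
  using rho_z_sum[of "Suc (degree r)" r] by (metis coeff_eq_0 Suc_le_eq)

lemma line_not_unit: "\<not> is_unit l"
  using rho_eq_0_iff[of 1] by simp

lemma line_nonzero: "l \<noteq> 0"
  using form_nonzero[OF line_form] .

lemma line_homogeneous: "homogeneous 1 l"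
  using form_homogeneous[OF line_form] line_tdeg by simp

lemma line_dvd_mult_iff: "l dvd F * G \<longleftrightarrow> l dvd F \<or> l dvd G"
  by (simp add: rho_mult flip: rho_eq_0_iff)

end

section \<open>Regular pairs\<close>

text \<open>\<open>G\<close> is a nonzerodivisor modulo \<open>F\<close>. For forms this is what coprimality amounts to, but
  in this shape it passes to powers and yields the syzygies of \<open>(F, G)\<close> without any appeal
  to unique factorization in \<open>k[x,y]\<close>. As a conditional rewrite rule the third conjunct does
  not terminate, so it is only used through rules.\<close>

definition regular_pair :: "'a::idom \<Rightarrow> 'a \<Rightarrow> bool" where
  "regular_pair F G \<longleftrightarrow> F \<noteq> 0 \<and> G \<noteq> 0 \<and> (\<forall>B. F dvd B * G \<longrightarrow> F dvd B)"

lemma regular_pair_nonzero: "regular_pair F G \<Longrightarrow> F \<noteq> 0" "regular_pair F G \<Longrightarrow> G \<noteq> 0"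
  by (auto simp: regular_pair_def)

lemma regular_pairI:
  "F \<noteq> 0 \<Longrightarrow> G \<noteq> 0 \<Longrightarrow> (\<And>B. F dvd B * G \<Longrightarrow> F dvd B) \<Longrightarrow> regular_pair F G"
  unfolding regular_pair_def by blast

lemma regular_pairD: "regular_pair F G \<Longrightarrow> F dvd B * G \<Longrightarrow> F dvd B"
  unfolding regular_pair_def by blast

lemma regular_pair_sym:
  assumes "regular_pair F G" shows "regular_pair G F"
proof (rule regular_pairI)
  fix B assume "G dvd B * F"
  then obtain S where S: "B * F = G * S" by blast
  then have "F dvd S * G" by (metis dvd_triv_right mult.commute)
  then have "F dvd S" by (rule regular_pairD[OF assms])
  then obtain T where "S = F * T" by (rule dvdE)
  then have "F * B = F * (G * T)" using S by (metis mult.left_commute mult.commute)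
  then have "B = G * T" using regular_pair_nonzero[OF assms] by simp
  then show "G dvd B" by simp
qed (use regular_pair_nonzero[OF assms] in auto)

lemma regular_pair_power_right: "regular_pair F G \<Longrightarrow> regular_pair F (G ^ n)"
proof (induction n)
  case (Suc n)
  have dvd: "F dvd B" if "F dvd B * G ^ Suc n" for B
  proof -
    have "F dvd (B * G) * G ^ n" using that by (simp add: ac_simps)
    then have "F dvd B * G" using Suc regular_pairD by blast
    then show ?thesis using Suc.prems regular_pairD by blast
  qed
  have "F \<noteq> 0" "G ^ Suc n \<noteq> 0" using regular_pair_nonzero[OF Suc.prems] by auto
  then show ?case using dvd by (rule regular_pairI)
qed (auto intro: regular_pairI dest: regular_pair_nonzero)

lemma regular_pair_power: "regular_pair F G \<Longrightarrow> regular_pair (F ^ m) (G ^ n)"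
  by (rule regular_pair_power_right[OF regular_pair_sym[OF regular_pair_power_right[OF regular_pair_sym]]])

text \<open>The syzygies of a regular pair are the multiples of the Koszul syzygy \<open>(G, -F)\<close>.\<close>

lemma regular_pair_syzygy:
  assumes "regular_pair F G" "A * F + B * G = 0"
  shows "\<exists>C. A = C * G \<and> B = - C * F"
proof -
  have BG: "B * G = - A * F" using assms(2) by (simp add: eq_neg_iff_add_eq_0 add.commute)
  then have "F dvd B * G" by simp
  then have "F dvd B" by (rule regular_pairD[OF assms(1)])
  then obtain C where C: "B = F * C" by (rule dvdE)
  have "A * F = (- C * G) * F" using BG C by (simp add: algebra_simps)
  then have "A = - C * G" using regular_pair_nonzero[OF assms(1)] mult_right_cancel by blast
  then show ?thesis using C by (intro exI[of _ "- C"]) simp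
qed

lemma regular_pair_syzygy':
  assumes "regular_pair F G" "A * G = B * F"
  shows "\<exists>C. A = C * F \<and> B = C * G"
proof -
  have "- B * F + A * G = 0" using assms(2) by simp
  from regular_pair_syzygy[OF assms(1) this] obtain C where "- B = C * G" "A = - C * F" by blast
  then have "A = (- C) * F \<and> B = (- C) * G" by (metis minus_minus mult_minus_left)
  then show ?thesis by blast
qed

lemma regular_pair_no_common_factor:
  assumes "regular_pair F G" "D dvd F" "D dvd G" shows "is_unit D"
proof -
  obtain S T where ST: "F = D * S" "G = D * T" using assms(2,3) by (auto elim!: dvdE)
  have "S * G = T * F" using ST by (simp add: ac_simps)
  then obtain C where C: "S = C * F" using regular_pair_syzygy'[OF assms(1)] by blast
  then have "S * (C * D) = S" using ST by (metis mult.assoc mult.commute)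
  moreover have "S \<noteq> 0" using ST regular_pair_nonzero[OF assms(1)] by auto
  ultimately have "C * D = 1" by simp
  then show ?thesis by (metis dvd_triv_right)
qed

lemma Y_dvd_iff: "Y\<^sub>R dvd F \<longleftrightarrow> poly F 0 = 0"
  using poly_eq_0_iff_dvd[of F 0] by simp

lemma homogeneous_mod_Y:
  fixes F :: "'k::field poly poly"
  assumes "homogeneous (int d) F" shows "poly F 0 = monom (coeff (coeff F 0) d) d"
proof (unfold poly_0_coeff_0, rule poly_eqI)
  show "coeff (coeff F 0) i = coeff (monom (coeff (coeff F 0) d) d) i" for i
    using homogeneousD[OF assms, of 0 i] by auto
qed

lemma regular_pair_unit: "is_unit F \<Longrightarrow> G \<noteq> 0 \<Longrightarrow> regular_pair F G"
  by (auto intro: regular_pairI)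

lemma regular_pair_add_multiple:
  fixes F G S :: "'k::field poly poly"
  assumes reg: "regular_pair F G'" and FY: "\<not> Y\<^sub>R dvd F" and nz: "S * F + Y\<^sub>R * G' \<noteq> 0"
  shows "regular_pair F (S * F + Y\<^sub>R * G')"
proof (rule regular_pairI)
  fix B assume "F dvd B * (S * F + Y\<^sub>R * G')"
  moreover have "B * (S * F + Y\<^sub>R * G') = F * (B * S) + (B * Y\<^sub>R) * G'" by algebra
  ultimately have "F dvd (B * Y\<^sub>R) * G'" by (metis dvd_add_right_iff dvd_triv_left)
  then have "F dvd B * Y\<^sub>R" by (rule regular_pairD[OF reg])
  then obtain T where T: "B * Y\<^sub>R = F * T" by (rule dvdE)
  then have "Y\<^sub>R dvd F * T" by (metis dvd_triv_right)
  then have "Y\<^sub>R dvd T" using FY by (simp add: Y_dvd_iff)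
  then obtain T' where "T = Y\<^sub>R * T'" by (rule dvdE)
  then have "B * Y\<^sub>R = (F * T') * Y\<^sub>R" using T by algebra
  then have "B = F * T'" by (subst (asm) mult_right_cancel) auto
  then show "F dvd B" by simp
qed (use nz regular_pair_nonzero[OF reg] in auto)

text \<open>Modulo \<open>y\<close> a form of degree \<open>d\<close> is a multiple of \<open>x\<^sup>d\<close>, so a suitable multiple of \<open>F\<close>
  cancels the pure power of \<open>x\<close> in \<open>G\<close>, unless there is none.\<close>

lemma exists_multiple_cong_mod_Y:
  fixes F G :: "'k::field poly poly"
  assumes F: "homogeneous (int a) F" and G: "homogeneous (int b) G"
    and FY: "\<not> Y\<^sub>R dvd F" and ab: "a \<le> b \<or> Y\<^sub>R dvd G"
  shows "\<exists>S G'. homogeneous (int b - 1) G' \<and> G = S * F + Y\<^sub>R * G'"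
proof -
  obtain S where S: "homogeneous (int b) (S * F)" "Y\<^sub>R dvd G - S * F"
  proof (cases "Y\<^sub>R dvd G")
    case True then show ?thesis using that[of 0] by simp
  next
    case False
    then have ab: "a \<le> b" using ab by simp
    define f where "f = coeff (coeff F 0) a"
    define g where "g = coeff (coeff G 0) b"
    have f: "poly F 0 = monom f a" and g: "poly G 0 = monom g b"
      using F G homogeneous_mod_Y f_def g_def by blast+
    have f0: "f \<noteq> 0" using FY f by (auto simp: Y_dvd_iff)
    define S where "S = [:[:g / f:]:] * X\<^sub>R ^ (b - a)"
    have "homogeneous (0 + int (b - a) * 1) S"
      unfolding S_def by (intro homogeneous_mult homogeneous_power homogeneous_const homogeneous_X)
    then have "homogeneous (int b - int a) S" using ab by (simp add: of_nat_diff)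
    then have "homogeneous (int b) (S * F)" using homogeneous_mult[OF _ F] by fastforce
    moreover have "poly S 0 = monom (g / f) (b - a)"
      by (simp add: S_def poly_power monom_altdef)
    then have "poly (G - S * F) 0 = 0"
      using f0 ab by (simp add: f g mult_monom)
    ultimately show ?thesis using that[of S] by (simp add: Y_dvd_iff)
  qed
  obtain G' where G': "G - S * F = Y\<^sub>R * G'" using S(2) by (rule dvdE)
  have "homogeneous (int b) (Y\<^sub>R * G')" using homogeneous_diff[OF G S(1)] G' by simp
  then have "homogeneous (int b - 1) G'"
    by (intro homogeneous_divide[OF homogeneous_Y]) (auto simp: mult.commute)
  moreover have "G = S * F + Y\<^sub>R * G'" using G' by algebra
  ultimately show ?thesis by blast
qed

text \<open>Euclid's algorithm for forms, as an induction on the sum of the degrees. Since \<open>F\<close> and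
  \<open>G\<close> are coprime, one of them is not divisible by \<open>y\<close>; if neither is, take the one of
  smaller degree. Subtracting a multiple of it from the other one makes the latter divisible
  by \<open>y\<close>, and cancelling \<open>y\<close> lowers the degree. Regularity is inherited because \<open>y\<close> is prime
  and does not divide the first form.\<close>

lemma coprime_forms_regular_aux:
  fixes F G :: "'k::field poly poly"
  assumes "homogeneous (int a) F" "homogeneous (int b) G" "F \<noteq> 0" "G \<noteq> 0" "coprime F G"
  shows "regular_pair F G"
  using assms
proof (induction "a + b" arbitrary: a b F G rule: less_induct)
  case less
  have step: "regular_pair P Q"
    if sum: "i + j = a + b" and P: "homogeneous (int i) P" and Q: "homogeneous (int j) Q"
      and nz: "P \<noteq> 0" "Q \<noteq> 0" and cop: "coprime P Q"
      and PY: "\<not> Y\<^sub>R dvd P" and le: "i \<le> j \<or> Y\<^sub>R dvd Q"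
    for i j and P Q :: "'k poly poly"
  proof -
    obtain S Q' where Q': "homogeneous (int j - 1) Q'" "Q = S * P + Y\<^sub>R * Q'"
      using exists_multiple_cong_mod_Y[OF P Q PY le] by blast
    show ?thesis
    proof (cases "Q' = 0")
      case True
      then have "P dvd Q" using Q'(2) by simp
      then have "is_unit P" using cop by (meson coprime_common_divisor dvd_refl)
      then show ?thesis using nz regular_pair_unit by blast
    next
      case False
      have j: "j > 0"
      proof (rule ccontr)
        assume "\<not> j > 0" then show False using homogeneous_negative[OF Q'(1)] False by simp
      qed
      have "coprime P Q'"
      proof (rule coprimeI)
        fix D assume D: "D dvd P" "D dvd Q'"
        then have "D dvd Q" unfolding Q'(2) by (intro dvd_add dvd_mult)
        then show "is_unit D" using cop D(1) coprime_common_divisor by blast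
      qed
      moreover have "i + (j - 1) < a + b" "homogeneous (int (j - 1)) Q'"
        using j sum Q'(1) by (auto simp: of_nat_diff)
      ultimately have "regular_pair P Q'"
        using less.hyps[OF _ P] nz(1) False by blast
      then show ?thesis using regular_pair_add_multiple[OF _ PY] Q'(2) nz(2) by blast
    qed
  qed
  have nY: "\<not> (Y\<^sub>R dvd F \<and> Y\<^sub>R dvd G)"
    using less.prems(5) coprime_common_divisor[of F G "Y\<^sub>R"] by (auto simp: Y_dvd_iff)
  show ?case
  proof (cases "\<not> Y\<^sub>R dvd F \<and> (a \<le> b \<or> Y\<^sub>R dvd G)")
    case True
    then show ?thesis using step[OF refl less.prems] by blast
  next
    case False
    then have *: "\<not> Y\<^sub>R dvd G" "b \<le> a \<or> Y\<^sub>R dvd F" using nY by auto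
    have "coprime G F" using less.prems(5) by (simp add: coprime_commute)
    then have "regular_pair G F"
      using step[OF add.commute less.prems(2,1,4,3) _ *] by blast
    then show ?thesis by (rule regular_pair_sym)
  qed
qed

lemma coprime_forms_regular:
  fixes F G :: "'k::field poly poly"
  assumes "is_form F" "is_form G" "coprime F G" shows "regular_pair F G"
  by (intro coprime_forms_regular_aux[OF form_homogeneous form_homogeneous] form_nonzero assms)

section \<open>Syzygies of three forms\<close>

text \<open>The rows \<open>(A1, B1, C1)\<close> and \<open>(A2, B2, C2)\<close> form a homogeneous matrix whose signed
  2-by-2 minors are \<open>F\<close>, \<open>G\<close>, \<open>H\<close>. By the Hilbert-Burch theorem a basis of the syzygies
  gives such a matrix up to a scalar, and conversely. The identities are preserved by row
  operations of determinant one and by the Frobenius endomorphism, which makes them easier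
  to propagate than exactness.\<close>

definition hilbert_burch ::
    "int \<Rightarrow> int \<Rightarrow> 'k::field poly poly \<Rightarrow> 'k poly poly \<Rightarrow> 'k poly poly
      \<Rightarrow> 'k poly poly \<Rightarrow> 'k poly poly \<Rightarrow> 'k poly poly
      \<Rightarrow> 'k poly poly \<Rightarrow> 'k poly poly \<Rightarrow> 'k poly poly \<Rightarrow> bool" where
  "hilbert_burch m m' F G H A1 B1 C1 A2 B2 C2 \<longleftrightarrow>
     homogeneous (m - int (tdeg F)) A1 \<and> homogeneous (m' - int (tdeg F)) A2 \<and>
     homogeneous (m - int (tdeg G)) B1 \<and> homogeneous (m' - int (tdeg G)) B2 \<and>
     homogeneous (m - int (tdeg H)) C1 \<and> homogeneous (m' - int (tdeg H)) C2 \<and>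
     B1 * C2 - C1 * B2 = F \<and> C1 * A2 - A1 * C2 = G \<and> A1 * B2 - B1 * A2 = H"

text \<open>Expansion of a determinant with two equal rows.\<close>

lemma hilbert_burch_syzygies:
  assumes "hilbert_burch m m' F G H A1 B1 C1 A2 B2 C2"
  shows "A1 * F + B1 * G + C1 * H = 0" "A2 * F + B2 * G + C2 * H = 0"
proof -
  have FGH: "F = B1 * C2 - C1 * B2" "G = C1 * A2 - A1 * C2" "H = A1 * B2 - B1 * A2"
    using assms by (auto simp: hilbert_burch_def)
  show "A1 * F + B1 * G + C1 * H = 0" "A2 * F + B2 * G + C2 * H = 0"
    unfolding FGH by (simp_all add: algebra_simps)
qed

text \<open>Cramer's rule. A syzygy \<open>s\<close> and the rows \<open>s1\<close>, \<open>s2\<close> are orthogonal to \<open>(F, G, H) = s1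
  \<times> s2\<close>, so \<open>s \<times> s1 = a (F, G, H)\<close> and \<open>s \<times> s2 = b (F, G, H)\<close>; then \<open>s = b s1 - a s2\<close>.\<close>

lemma hilbert_burch_generate:
  assumes hb: "hilbert_burch m m' F G H A1 B1 C1 A2 B2 C2" and reg: "regular_pair F G"
    and syz: "A * F + B * G + C * H = 0"
  shows "\<exists>P Q. A = P * A1 + Q * A2 \<and> B = P * B1 + Q * B2 \<and> C = P * C1 + Q * C2"
proof -
  \<comment> \<open>The cross product of two syzygies is parallel to \<open>(F, G, H)\<close>, hence a multiple of it.\<close>
  have cross: "\<exists>a. B * C' - C * B' = a * F \<and> C * A' - A * C' = a * G \<and> A * B' - B * A' = a * H"
    if s: "A' * F + B' * G + C' * H = 0" for A' B' C'
  proof -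
    have "(B * C' - C * B') * G = (C * A' - A * C') * F"
      using syz s by algebra
    then obtain a where a: "B * C' - C * B' = a * F" "C * A' - A * C' = a * G"
      using regular_pair_syzygy'[OF reg] by blast
    have "(A * B' - B * A') * F = a * H * F"
      using syz s a(1) by algebra
    then have "A * B' - B * A' = a * H"
      using regular_pair_nonzero[OF reg] by simp
    then show ?thesis using a by blast
  qed
  obtain a where a: "B * C1 - C * B1 = a * F" "C * A1 - A * C1 = a * G" "A * B1 - B * A1 = a * H"
    using cross[OF hilbert_burch_syzygies(1)[OF hb]] by blast
  obtain b where b: "B * C2 - C * B2 = b * F" "C * A2 - A * C2 = b * G" "A * B2 - B * A2 = b * H"
    using cross[OF hilbert_burch_syzygies(2)[OF hb]] by blast
  have FGH: "B1 * C2 - C1 * B2 = F" "C1 * A2 - A1 * C2 = G" "A1 * B2 - B1 * A2 = H"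
    using hb by (auto simp: hilbert_burch_def)
  have F: "F \<noteq> 0" using regular_pair_nonzero[OF reg] by simp
  have "A * F = (b * A1 + - a * A2) * F" using a b FGH by algebra
  moreover have "B * F = (b * B1 + - a * B2) * F" using a b FGH by algebra
  moreover have "C * F = (b * C1 + - a * C2) * F" using a b FGH by algebra
  ultimately have "A = b * A1 + - a * A2 \<and> B = b * B1 + - a * B2 \<and> C = b * C1 + - a * C2"
    using F by (metis mult_right_cancel)
  then show ?thesis by blast
qed

lemma hilbert_burch_resolution:
  assumes hb: "hilbert_burch m m' F G H A1 B1 C1 A2 B2 C2" and reg: "regular_pair F G"
  shows "syzygy_resolution m m' F G H"
  unfolding syzygy_resolution_def
proof (rule exI[of _ A1], rule exI[of _ B1], rule exI[of _ C1], rule exI[of _ A2],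
    rule exI[of _ B2], rule exI[of _ C2], intro conjI allI impI)
  note FGH = hb[unfolded hilbert_burch_def]
  show "homogeneous (m - int (tdeg F)) A1" "homogeneous (m' - int (tdeg F)) A2"
    "homogeneous (m - int (tdeg G)) B1" "homogeneous (m' - int (tdeg G)) B2"
    "homogeneous (m - int (tdeg H)) C1" "homogeneous (m' - int (tdeg H)) C2"
    using FGH by auto
  fix A B C
  show "A * F + B * G + C * H = 0 \<longleftrightarrow>
    (\<exists>P Q. A = P * A1 + Q * A2 \<and> B = P * B1 + Q * B2 \<and> C = P * C1 + Q * C2)" (is "?l \<longleftrightarrow> ?r")
  proof
    assume ?l then show ?r by (rule hilbert_burch_generate[OF hb reg])
  next
    assume ?r
    then obtain P Q where PQ: "A = P * A1 + Q * A2" "B = P * B1 + Q * B2" "C = P * C1 + Q * C2"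
      by blast
    have "A * F + B * G + C * H = P * (A1 * F + B1 * G + C1 * H) + Q * (A2 * F + B2 * G + C2 * H)"
      unfolding PQ by (simp add: algebra_simps)
    then show ?l by (simp add: hilbert_burch_syzygies[OF hb])
  qed
next
  fix P Q assume PQ: "P * A1 + Q * A2 = 0 \<and> P * B1 + Q * B2 = 0 \<and> P * C1 + Q * C2 = 0"
  have FGH: "B1 * C2 - C1 * B2 = F" using hb by (auto simp: hilbert_burch_def)
  have "P * F = 0" "Q * F = 0" using PQ FGH by algebra+
  then show "P = 0" "Q = 0" using regular_pair_nonzero[OF reg] by auto
qed

definition homogeneous_syzygy ::
    "'k::field poly poly \<Rightarrow> 'k poly poly \<Rightarrow> 'k poly poly \<Rightarrow> int
      \<Rightarrow> 'k poly poly \<Rightarrow> 'k poly poly \<Rightarrow> 'k poly poly \<Rightarrow> bool" where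
  "homogeneous_syzygy F G H e A B C \<longleftrightarrow>
     homogeneous (e - int (tdeg F)) A \<and> homogeneous (e - int (tdeg G)) B \<and>
     homogeneous (e - int (tdeg H)) C \<and> A * F + B * G + C * H = 0 \<and> (A \<noteq> 0 \<or> B \<noteq> 0 \<or> C \<noteq> 0)"

text \<open>The smaller of the two degrees of a resolution is the least degree of a nonzero
  homogeneous syzygy. Together with the sum of the two degrees this determines the
  resolution numerically.\<close>

lemma resolution_syzygies:
  assumes "syzygy_resolution m m' F G H"
  shows "\<exists>A B C. homogeneous_syzygy F G H m A B C" "\<exists>A B C. homogeneous_syzygy F G H m' A B C"
    and "homogeneous_syzygy F G H e A B C \<Longrightarrow> min m m' \<le> e"
proof -
  obtain A1 B1 C1 A2 B2 C2 where
    hom: "homogeneous (m - int (tdeg F)) A1" "homogeneous (m' - int (tdeg F)) A2"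
     "homogeneous (m - int (tdeg G)) B1" "homogeneous (m' - int (tdeg G)) B2"
     "homogeneous (m - int (tdeg H)) C1" "homogeneous (m' - int (tdeg H)) C2"
    and gen: "\<forall>A B C. A * F + B * G + C * H = 0 \<longleftrightarrow>
        (\<exists>P Q. A = P * A1 + Q * A2 \<and> B = P * B1 + Q * B2 \<and> C = P * C1 + Q * C2)"
    and inj: "\<forall>P Q. P * A1 + Q * A2 = 0 \<and> P * B1 + Q * B2 = 0 \<and> P * C1 + Q * C2 = 0 \<longrightarrow>
        P = 0 \<and> Q = 0"
    using assms[unfolded syzygy_resolution_def] by (elim exE conjE) (rule that)
  note gen = gen[rule_format] and inj = inj[rule_format]
  have 1: "A1 * F + B1 * G + C1 * H = 0" unfolding gen
    by (rule exI[of _ 1], rule exI[of _ 0]) simp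
  have 2: "A2 * F + B2 * G + C2 * H = 0" unfolding gen
    by (rule exI[of _ 0], rule exI[of _ 1]) simp
  have "A1 \<noteq> 0 \<or> B1 \<noteq> 0 \<or> C1 \<noteq> 0" using inj[of 1 0] by auto
  then show "\<exists>A B C. homogeneous_syzygy F G H m A B C"
    using hom 1 unfolding homogeneous_syzygy_def by meson
  have "A2 \<noteq> 0 \<or> B2 \<noteq> 0 \<or> C2 \<noteq> 0" using inj[of 0 1] by auto
  then show "\<exists>A B C. homogeneous_syzygy F G H m' A B C"
    using hom 2 unfolding homogeneous_syzygy_def by meson
  assume syz: "homogeneous_syzygy F G H e A B C"
  show "min m m' \<le> e"
  proof (rule ccontr)
    assume "\<not> min m m' \<le> e"
    then have e: "e < m" "e < m'" by auto
    obtain P Q where PQ: "A = P * A1 + Q * A2" "B = P * B1 + Q * B2" "C = P * C1 + Q * C2"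
      using syz gen[of A B C] unfolding homogeneous_syzygy_def by blast
    have zero: "S = 0" if "homogeneous (e - d) S" "S = P * S1 + Q * S2"
      "homogeneous (m - d) S1" "homogeneous (m' - d) S2" for S S1 S2 d
    proof -
      have "S = hcomp (e - d) (P * S1 + Q * S2)" using that(1,2) hcomp_homogeneous by metis
      also have "\<dots> = 0"
        using e by (simp add: hcomp_add hcomp_mult[OF that(3)] hcomp_mult[OF that(4)] hcomp_negative)
      finally show ?thesis .
    qed
    have "A = 0" "B = 0" "C = 0"
      using syz zero[OF _ PQ(1) hom(1,2)] zero[OF _ PQ(2) hom(3,4)] zero[OF _ PQ(3) hom(5,6)]
      by (auto simp: homogeneous_syzygy_def)
    then show False using syz by (simp add: homogeneous_syzygy_def)
  qed
qed

text \<open>The minors of any resolution agree with \<open>(F, G, H)\<close> up to a nonzero constant, so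
  comparing the degree of one minor with that of \<open>F\<close> gives the sum of the two degrees.\<close>

lemma resolution_degree_sum:
  assumes hb: "hilbert_burch m m' F G H A1 B1 C1 A2 B2 C2" and reg: "regular_pair F G"
    and forms: "is_form F" "is_form G" and res: "syzygy_resolution n n' F G H"
  shows "n + n' = int (tdeg F) + int (tdeg G) + int (tdeg H)"
proof -
  have F: "homogeneous (int (tdeg F)) F" "F \<noteq> 0"
    using forms form_homogeneous form_nonzero by auto
  obtain A3 B3 C3 A4 B4 C4 where
    hom: "homogeneous (n - int (tdeg G)) B3" "homogeneous (n' - int (tdeg G)) B4"
     "homogeneous (n - int (tdeg H)) C3" "homogeneous (n' - int (tdeg H)) C4"
    and gen: "\<forall>A B C. A * F + B * G + C * H = 0 \<longleftrightarrow>
        (\<exists>P Q. A = P * A3 + Q * A4 \<and> B = P * B3 + Q * B4 \<and> C = P * C3 + Q * C4)"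
    using res[unfolded syzygy_resolution_def] by (elim exE conjE) (rule that)
  note gen = gen[rule_format]
  \<comment> \<open>The two bases differ by an invertible matrix, so their minors differ by a unit.\<close>
  obtain P1 Q1 P2 Q2 where 12: "B1 = P1 * B3 + Q1 * B4" "C1 = P1 * C3 + Q1 * C4"
    "B2 = P2 * B3 + Q2 * B4" "C2 = P2 * C3 + Q2 * C4"
    using hilbert_burch_syzygies[OF hb] gen[of A1 B1 C1] gen[of A2 B2 C2] by blast
  have s3: "A3 * F + B3 * G + C3 * H = 0" unfolding gen
    by (rule exI[of _ 1], rule exI[of _ 0]) simp
  have s4: "A4 * F + B4 * G + C4 * H = 0" unfolding gen
    by (rule exI[of _ 0], rule exI[of _ 1]) simp
  obtain P3 Q3 where 3: "B3 = P3 * B1 + Q3 * B2" "C3 = P3 * C1 + Q3 * C2"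
    using hilbert_burch_generate[OF hb reg s3] by blast
  obtain P4 Q4 where 4: "B4 = P4 * B1 + Q4 * B2" "C4 = P4 * C1 + Q4 * C2"
    using hilbert_burch_generate[OF hb reg s4] by blast
  have FF: "B1 * C2 - C1 * B2 = F" using hb by (simp add: hilbert_burch_def)
  define E where "E = B3 * C4 - C3 * B4"
  have E: "E = (P3 * Q4 - Q3 * P4) * F" unfolding E_def 3 4 FF[symmetric] by (simp add: algebra_simps)
  have "F = (P1 * Q2 - Q1 * P2) * E" unfolding FF[symmetric] 12 E_def by (simp add: algebra_simps)
  then have "F * ((P1 * Q2 - Q1 * P2) * (P3 * Q4 - Q3 * P4)) = F" using E by (simp add: ac_simps)
  then have "(P1 * Q2 - Q1 * P2) * (P3 * Q4 - Q3 * P4) = 1" using F by simp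
  then have "is_unit (P3 * Q4 - Q3 * P4)" by (metis dvd_triv_right)
  then obtain c where c: "c \<noteq> 0" "P3 * Q4 - Q3 * P4 = [:[:c:]:]" using is_unit_poly_poly by blast
  have "homogeneous (0 + int (tdeg F)) E" unfolding E c
    by (intro homogeneous_mult homogeneous_const F)
  moreover have "homogeneous ((n - int (tdeg G)) + (n' - int (tdeg H))) (B3 * C4)"
    by (intro homogeneous_mult hom)
  moreover have "homogeneous ((n - int (tdeg H)) + (n' - int (tdeg G))) (C3 * B4)"
    by (intro homogeneous_mult hom)
  then have "homogeneous ((n - int (tdeg G)) + (n' - int (tdeg H))) (C3 * B4)"
    by (simp add: algebra_simps)
  ultimately have "homogeneous (int (tdeg F)) E"
    "homogeneous ((n - int (tdeg G)) + (n' - int (tdeg H))) E"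
    unfolding E_def by (auto intro: homogeneous_diff)
  moreover have "E \<noteq> 0" using E c F by auto
  ultimately show ?thesis using homogeneous_unique by fastforce
qed

lemma syzygy_gap_eq:
  assumes hb: "hilbert_burch m m' F G H A1 B1 C1 A2 B2 C2" and reg: "regular_pair F G"
    and forms: "is_form F" "is_form G"
  shows "syzygy_gap F G H = \<bar>m - m'\<bar>"
  unfolding syzygy_gap_def
proof (rule the_equality)
  have res: "syzygy_resolution m m' F G H" by (rule hilbert_burch_resolution[OF hb reg])
  then show "\<exists>n n'. syzygy_resolution n n' F G H \<and> \<bar>m - m'\<bar> = \<bar>n - n'\<bar>" by blast
  fix d assume "\<exists>n n'. syzygy_resolution n n' F G H \<and> d = \<bar>n - n'\<bar>"
  then obtain n n' where n: "syzygy_resolution n n' F G H" "d = \<bar>n - n'\<bar>" by blast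
  have "n + n' = m + m'"
    using resolution_degree_sum[OF hb reg forms n(1)] resolution_degree_sum[OF hb reg forms res]
    by simp
  moreover have "min n n' = min m m'"
    using resolution_syzygies[OF n(1)] resolution_syzygies[OF res]
    by (metis (full_types) min_def order_antisym)
  ultimately show "d = \<bar>m - m'\<bar>" using n(2) by (auto simp: min_def split: if_splits)
qed

lemma hilbert_burch_degree_sum:
  assumes hb: "hilbert_burch m m' F G H A1 B1 C1 A2 B2 C2" and reg: "regular_pair F G"
    and forms: "is_form F" "is_form G"
  shows "m + m' = int (tdeg F) + int (tdeg G) + int (tdeg H)"
  using resolution_degree_sum[OF hb reg forms hilbert_burch_resolution[OF hb reg]] .

section \<open>Colength of ideals\<close>

lemma module_ring: "module ((*) :: 'a::comm_ring_1 \<Rightarrow> 'a \<Rightarrow> 'a)"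
  by unfold_locales (auto simp: algebra_simps)

lemma ideal_gen_add: "f \<in> ideal_gen S \<Longrightarrow> g \<in> ideal_gen S \<Longrightarrow> f + g \<in> ideal_gen S"
  unfolding ideal_gen_def by (rule module.span_add[OF module_ring])

lemma ideal_gen_diff: "f \<in> ideal_gen S \<Longrightarrow> g \<in> ideal_gen S \<Longrightarrow> f - g \<in> ideal_gen S"
  unfolding ideal_gen_def by (rule module.span_diff[OF module_ring])

lemma ideal_gen_mult: "f \<in> ideal_gen S \<Longrightarrow> r * f \<in> ideal_gen S"
  unfolding ideal_gen_def by (rule module.span_scale[OF module_ring])

lemma ideal_gen_0: "0 \<in> ideal_gen S"
  unfolding ideal_gen_def by (rule module.span_zero[OF module_ring])

lemma ideal_gen_sum: "(\<And>i. i \<in> J \<Longrightarrow> f i \<in> ideal_gen S) \<Longrightarrow> (\<Sum>i\<in>J. f i) \<in> ideal_gen S"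
  unfolding ideal_gen_def by (rule module.span_sum[OF module_ring])

lemma ideal_gen_pair: "f \<in> ideal_gen {F, G} \<longleftrightarrow> (\<exists>A B. f = A * F + B * G)"
  for F G :: "'a::comm_ring_1"
proof -
  have "f \<in> ideal_gen {F, G} \<longleftrightarrow> (\<exists>A B. f - A * F - B * G = 0)"
    by (simp add: ideal_gen_def module.span_insert[OF module_ring] module.span_empty[OF module_ring])
  then show ?thesis by (simp add: algebra_simps)
qed

lemma ideal_gen_triple: "f \<in> ideal_gen {F, G, H} \<longleftrightarrow> (\<exists>A B C. f = A * F + B * G + C * H)"
  for F G H :: "'a::comm_ring_1"
proof -
  have "f \<in> ideal_gen {F, G, H} \<longleftrightarrow> (\<exists>A B C. f - A * F - B * G - C * H = 0)"
    by (simp add: ideal_gen_def module.span_insert[OF module_ring] module.span_empty[OF module_ring])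
  then show ?thesis by (simp add: algebra_simps)
qed

text \<open>A basis of \<open>R/I\<close> as an indexed family. In contrast to \<open>quotient_basis\<close>, bases of the
  layers of a filtration can be concatenated without checking that their elements are
  distinct.\<close>

definition has_colength :: "'k::field poly poly set \<Rightarrow> nat \<Rightarrow> bool" where
  "has_colength I D \<longleftrightarrow> (\<exists>\<beta> :: nat \<Rightarrow> 'k poly poly.
     (\<forall>c. (\<Sum>i<D. smult [:c i:] (\<beta> i)) \<in> I \<longrightarrow> (\<forall>i<D. c i = 0)) \<and>
     (\<forall>f. \<exists>c. f - (\<Sum>i<D. smult [:c i:] (\<beta> i)) \<in> I))"

interpretation scalars: vector_space "\<lambda>(c :: 'k::field) (f :: 'k poly poly). smult [:c:] f"
  by unfold_locales
    (simp_all add: smult_add_right mult.commute flip: smult_add_left one_pCons)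

text \<open>Reducing the elements of \<open>B'\<close> modulo \<open>I\<close> to linear combinations of \<open>B\<close> keeps them
  linearly independent, so the bound is the one for independent sets in the span of \<open>B\<close>.\<close>

lemma quotient_basis_card_le:
  fixes B B' :: "'k::field poly poly set"
  assumes B: "quotient_basis (ideal_gen S) B" and B': "quotient_basis (ideal_gen S) B'"
  shows "card B' \<le> card B"
proof -
  let ?I = "ideal_gen S"
  have fin: "finite B" "finite B'" using B B' by (auto simp: quotient_basis_def)
  have ind: "\<forall>b\<in>B'. c b = 0" if "(\<Sum>b\<in>B'. smult [:c b:] b) \<in> ?I" for c
    using B' that unfolding quotient_basis_def by blast
  have "\<forall>f. \<exists>c :: 'k poly poly \<Rightarrow> 'k. f - (\<Sum>b\<in>B. smult [:c b:] b) \<in> ?I"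
    using B unfolding quotient_basis_def by blast
  then obtain c :: "'k poly poly \<Rightarrow> 'k poly poly \<Rightarrow> 'k"
    where c: "\<And>f. f - (\<Sum>b\<in>B. smult [:c f b:] b) \<in> ?I" by metis
  define r where "r = (\<lambda>f. \<Sum>b\<in>B. smult [:c f b:] b)"
  have r: "f - r f \<in> ?I" for f using c by (simp add: r_def)
  have smult: "smult [:a:] f \<in> ?I" if "f \<in> ?I" for a :: 'k and f
    using ideal_gen_mult[OF that, of "[:[:a:]:]"] by simp
  have zero: "\<forall>b\<in>B'. u b = 0" if "(\<Sum>b\<in>B'. smult [:u b:] (r b)) = 0" for u
  proof (rule ind)
    have "(\<Sum>b\<in>B'. smult [:u b:] b) = (\<Sum>b\<in>B'. smult [:u b:] (b - r b))"
      using that by (simp add: smult_diff_right sum_subtractf)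
    also have "\<dots> \<in> ?I" by (intro ideal_gen_sum smult r)
    finally show "(\<Sum>b\<in>B'. smult [:u b:] b) \<in> ?I" .
  qed
  have inj: "inj_on r B'"
  proof (rule inj_onI, rule ccontr)
    fix x y assume xy: "x \<in> B'" "y \<in> B'" "r x = r y" "x \<noteq> y"
    define u where "u = (\<lambda>b. if b = x then 1 else if b = y then - 1 else 0 :: 'k)"
    have "(\<Sum>b\<in>B'. smult [:u b:] (r b)) = (\<Sum>b\<in>{x, y}. smult [:u b:] (r b))"
      using xy fin by (intro sum.mono_neutral_right) (auto simp: u_def)
    also have "\<dots> = 0" using xy by (simp add: u_def flip: one_pCons)
    finally have "u x = 0" using zero xy(1) by blast
    then show False by (simp add: u_def)
  qed
  have "scalars.independent (r ` B')"
    unfolding scalars.dependent_finite[OF finite_imageI[OF fin(2)]]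
  proof (safe)
    fix u b assume "(\<Sum>v\<in>r ` B'. smult [:u v:] v) = 0" "b \<in> B'" "u (r b) \<noteq> 0"
    then show False using zero[of "u \<circ> r"] inj by (simp add: sum.reindex)
  qed
  moreover have "r ` B' \<subseteq> scalars.span B"
    unfolding r_def
    by (intro image_subsetI scalars.span_sum) (rule scalars.span_scale[OF scalars.span_base])
  ultimately have "card (r ` B') \<le> card B"
    using scalars.independent_span_bound[OF fin(1)] by blast
  then show ?thesis using inj by (simp add: card_image)
qed

lemma ideal_deg_eq:
  fixes S :: "'k::field poly poly set"
  assumes "has_colength (ideal_gen S) D" shows "ideal_deg (ideal_gen S) = D"
proof -
  obtain \<beta> :: "nat \<Rightarrow> 'k poly poly" where
    ind: "\<And>c. (\<Sum>i<D. smult [:c i:] (\<beta> i)) \<in> ideal_gen S \<Longrightarrow> (\<forall>i<D. c i = 0)" and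
    span: "\<And>f. \<exists>c. f - (\<Sum>i<D. smult [:c i:] (\<beta> i)) \<in> ideal_gen S"
    using assms unfolding has_colength_def by blast
  have inj: "inj_on \<beta> {..<D}"
  proof (rule inj_onI, rule ccontr)
    fix i j assume ij: "i \<in> {..<D}" "j \<in> {..<D}" "\<beta> i = \<beta> j" "i \<noteq> j"
    define u where "u = (\<lambda>b. if b = i then 1 else if b = j then - 1 else 0 :: 'k)"
    have "(\<Sum>b<D. smult [:u b:] (\<beta> b)) = (\<Sum>b\<in>{i, j}. smult [:u b:] (\<beta> b))"
      using ij by (intro sum.mono_neutral_right) (auto simp: u_def)
    also have "\<dots> = 0" using ij by (simp add: u_def flip: one_pCons)
    finally have "(\<Sum>b<D. smult [:u b:] (\<beta> b)) \<in> ideal_gen S" using ideal_gen_0 by simp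
    then have "u i = 0" using ind ij(1) by blast
    then show False by (simp add: u_def)
  qed
  have basis: "quotient_basis (ideal_gen S) (\<beta> ` {..<D})"
    unfolding quotient_basis_def
  proof (intro conjI allI impI ballI)
    fix c b assume "(\<Sum>b\<in>\<beta> ` {..<D}. smult [:c b:] b) \<in> ideal_gen S" "b \<in> \<beta> ` {..<D}"
    then show "c b = 0" using ind[of "c \<circ> \<beta>"] inj by (auto simp: sum.reindex)
  next
    fix f
    obtain c where c: "f - (\<Sum>i<D. smult [:c i:] (\<beta> i)) \<in> ideal_gen S" using span by blast
    have eq: "(\<Sum>b\<in>\<beta> ` {..<D}. smult [:(c \<circ> inv_into {..<D} \<beta>) b:] b) = (\<Sum>i<D. smult [:c i:] (\<beta> i))"
      using inj by (auto simp: sum.reindex intro!: sum.cong)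
    show "\<exists>c. f - (\<Sum>b\<in>\<beta> ` {..<D}. smult [:c b:] b) \<in> ideal_gen S"
      by (rule exI[of _ "c \<circ> inv_into {..<D} \<beta>"]) (unfold eq, rule c)
  qed simp
  have card: "card (\<beta> ` {..<D}) = D" using inj by (simp add: card_image)
  show ?thesis
    unfolding ideal_deg_def
  proof (rule the_equality)
    show "\<exists>B. quotient_basis (ideal_gen S) B \<and> card B = D" using basis card by blast
  next
    fix d assume "\<exists>B. quotient_basis (ideal_gen S) B \<and> card B = d"
    then obtain B where "quotient_basis (ideal_gen S) B" "card B = d" by blast
    then show "d = D"
      using quotient_basis_card_le[OF basis] quotient_basis_card_le[OF _ basis] card
      by (metis order_antisym)
  qed
qed

text \<open>Additivity of dimension along \<open>R/J \<rightarrow> R/I\<close>, with \<open>\<gamma>\<close> a basis of \<open>I/J\<close>.\<close>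

lemma has_colength_extend:
  fixes \<gamma> :: "nat \<Rightarrow> 'k::field poly poly"
  assumes I: "has_colength I D" and sub: "J \<subseteq> I"
    and add: "\<And>f g. f \<in> I \<Longrightarrow> g \<in> I \<Longrightarrow> f + g \<in> I" "\<And>f g. f \<in> I \<Longrightarrow> g \<in> I \<Longrightarrow> f - g \<in> I"
    and gam: "\<And>c. (\<Sum>i<N. smult [:c i:] (\<gamma> i)) \<in> I"
    and ind: "\<And>c. (\<Sum>i<N. smult [:c i:] (\<gamma> i)) \<in> J \<Longrightarrow> (\<forall>i<N. c i = 0)"
    and span: "\<And>f. f \<in> I \<Longrightarrow> \<exists>c. f - (\<Sum>i<N. smult [:c i:] (\<gamma> i)) \<in> J"
  shows "has_colength J (D + N)"
proof -
  obtain \<beta> :: "nat \<Rightarrow> 'k poly poly" where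
    ind': "\<And>c. (\<Sum>i<D. smult [:c i:] (\<beta> i)) \<in> I \<Longrightarrow> (\<forall>i<D. c i = 0)" and
    span': "\<And>f. \<exists>c. f - (\<Sum>i<D. smult [:c i:] (\<beta> i)) \<in> I"
    using I unfolding has_colength_def by blast
  define \<eta> where "\<eta> = (\<lambda>i. if i < D then \<beta> i else \<gamma> (i - D))"
  have split: "(\<Sum>i<D + N. smult [:c i:] (\<eta> i)) =
      (\<Sum>i<D. smult [:c i:] (\<beta> i)) + (\<Sum>i<N. smult [:c (D + i):] (\<gamma> i))" for c
    using sum.atLeastLessThan_concat[of 0 D "D + N" "\<lambda>i. smult [:c i:] (\<eta> i)"]
      sum.shift_bounds_nat_ivl[of "\<lambda>i. smult [:c i:] (\<eta> i)" 0 D N]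
    by (simp add: \<eta>_def lessThan_atLeast0 add.commute)
  show ?thesis
    unfolding has_colength_def
  proof (intro exI[of _ \<eta>] conjI allI impI)
    fix c i assume c: "(\<Sum>i<D + N. smult [:c i:] (\<eta> i)) \<in> J" and i: "i < D + N"
    have "(\<Sum>i<D. smult [:c i:] (\<beta> i)) \<in> I"
      using add(2)[OF subsetD[OF sub c] gam[of "\<lambda>i. c (D + i)"]] by (simp add: split)
    then have 0: "\<forall>i<D. c i = 0" by (rule ind')
    then have "(\<Sum>i<N. smult [:c (D + i):] (\<gamma> i)) \<in> J" using c by (simp add: split)
    then have "\<forall>i<N. c (D + i) = 0" by (rule ind)
    then show "c i = 0" using 0 i by (metis add_diff_inverse_nat nat_add_left_cancel_less)
  next
    fix f
    obtain c where c: "f - (\<Sum>i<D. smult [:c i:] (\<beta> i)) \<in> I" using span' by blast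
    obtain d where d: "f - (\<Sum>i<D. smult [:c i:] (\<beta> i)) - (\<Sum>i<N. smult [:d i:] (\<gamma> i)) \<in> J"
      using span[OF c] by blast
    show "\<exists>c. f - (\<Sum>i<D + N. smult [:c i:] (\<eta> i)) \<in> J"
      using d by (intro exI[of _ "\<lambda>i. if i < D then c i else d (i - D)"])
        (simp add: split diff_diff_eq)
  qed
qed

section \<open>Multiplying the third form by a linear form\<close>

lemma hilbert_burch_swap:
  "hilbert_burch m m' F G H A1 B1 C1 A2 B2 C2 \<Longrightarrow>
     hilbert_burch m' m F G H A2 B2 C2 (- A1) (- B1) (- C1)"
  unfolding hilbert_burch_def by (auto intro: homogeneous_uminus)

lemma hilbert_burch_shear:
  assumes "hilbert_burch m m' F G H A1 B1 C1 A2 B2 C2" "homogeneous (m' - m) S"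
  shows "hilbert_burch m m' F G H A1 B1 C1 (A2 - S * A1) (B2 - S * B1) (C2 - S * C1)"
proof -
  have "homogeneous (m' - d) (P2 - S * P1)" if "homogeneous (m - d) P1" "homogeneous (m' - d) P2"
    for d P1 P2
    using homogeneous_diff[OF that(2)] homogeneous_mult[OF assms(2) that(1)] by simp
  then show ?thesis using assms(1) unfolding hilbert_burch_def by (simp add: algebra_simps)
qed

context line_restriction
begin

text \<open>A basis of syzygies adapted to \<open>l\<close>. The last entries cannot both be divisible by \<open>l\<close>,
  for then \<open>l\<close> would divide \<open>F\<close> and \<open>G\<close>. If neither is, a multiple of the syzygy of smaller
  degree is subtracted from the other one to make its last entry vanish on the line \<open>l =
  0\<close>.\<close>

lemma hilbert_burch_reduce:
  assumes hb: "hilbert_burch m m' F G H A1 B1 C1 A2 B2 C2" and reg: "regular_pair F G"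
  shows "\<exists>n n' A1 B1 C1 A2 B2 C2. (n = m \<and> n' = m' \<or> n = m' \<and> n' = m) \<and>
    hilbert_burch n n' F G H A1 B1 C1 A2 B2 C2 \<and> \<not> l dvd C1 \<and> l dvd C2"
proof -
  have ordered: "\<exists>A1 B1 C1 A2 B2 C2.
      hilbert_burch m m' F G H A1 B1 C1 A2 B2 C2 \<and> \<not> l dvd C1 \<and> l dvd C2"
    if hb: "hilbert_burch m m' F G H A1 B1 C1 A2 B2 C2" and le: "m \<le> m'"
      and C: "\<not> l dvd C1" "\<not> l dvd C2" for m m' A1 B1 C1 A2 B2 C2
  proof -
    define h where "h = int (tdeg H)"
    have hom: "homogeneous (m - h) C1" "homogeneous (m' - h) C2"
      using hb by (auto simp: hilbert_burch_def h_def)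
    have deg: "m - h \<ge> 0" "m' - h \<ge> 0"
      using C homogeneous_negative[OF hom(1)] homogeneous_negative[OF hom(2)] by fastforce+
    obtain c1 where c1: "\<rho> C1 = monom c1 (nat (m - h))"
      using rho_homogeneous[of "nat (m - h)" C1] hom deg by auto
    obtain c2 where c2: "\<rho> C2 = monom c2 (nat (m' - h))"
      using rho_homogeneous[of "nat (m' - h)" C2] hom deg by auto
    have c10: "c1 \<noteq> 0" using C c1 by (auto simp flip: rho_eq_0_iff)
    define S where "S = [:[:c2 / c1:]:] * z ^ nat (m' - m)"
    have "homogeneous (0 + int (nat (m' - m)) * 1) S"
      unfolding S_def by (intro homogeneous_mult homogeneous_const homogeneous_power z_homogeneous)
    then have S: "homogeneous (m' - m) S" using le by simp
    have "\<rho> S = smult (c2 / c1) ([:0, 1:] ^ nat (m' - m))"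
      unfolding S_def rho_mult rho_power rho_z rho_const by simp
    then have rS: "\<rho> S = monom (c2 / c1) (nat (m' - m))" by (simp add: monom_altdef)
    have "nat (m' - m) + nat (m - h) = nat (m' - h)" using deg le by simp
    then have "\<rho> (C2 - S * C1) = 0"
      using c10 by (simp add: rho_diff rho_mult rS c1 c2 mult_monom)
    then have "l dvd C2 - S * C1" by (simp add: rho_eq_0_iff)
    then show ?thesis using hilbert_burch_shear[OF hb S] C by blast
  qed
  have not_both: "\<not> (l dvd C1 \<and> l dvd C2)"
  proof
    assume C: "l dvd C1 \<and> l dvd C2"
    have "F = B1 * C2 - C1 * B2" "G = C1 * A2 - A1 * C2" using hb by (auto simp: hilbert_burch_def)
    then have "l dvd F" "l dvd G" using C by (auto intro!: dvd_diff dvd_mult dvd_mult2)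
    then show False using regular_pair_no_common_factor[OF reg] line_not_unit by blast
  qed
  consider "\<not> l dvd C1" "l dvd C2" | "l dvd C1" "\<not> l dvd C2" | "\<not> l dvd C1" "\<not> l dvd C2"
    using not_both by blast
  then show ?thesis
  proof cases
    case 1 then show ?thesis using hb by blast
  next
    case 2
    then have "l dvd - C1" by simp
    then show ?thesis using hilbert_burch_swap[OF hb] 2 by blast
  next
    case 3
    show ?thesis
    proof (cases "m \<le> m'")
      case True then show ?thesis using ordered[OF hb True 3] by blast
    next
      case False
      then have "m' \<le> m" by simp
      moreover have "\<not> l dvd - C1" using 3 by simp
      ultimately show ?thesis using ordered[OF hilbert_burch_swap[OF hb]] 3(2) by blast
    qed
  qed
qed

text \<open>The syzygies of \<open>(F, G, l H)\<close> are those syzygies of \<open>(F, G, H)\<close> whose last entry is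
  divisible by \<open>l\<close>, with that entry divided by \<open>l\<close>. The second row is of this kind already;
  the first one is multiplied by \<open>l\<close>.\<close>

lemma hilbert_burch_mult_line:
  assumes hb: "hilbert_burch n n' F G H A1 B1 C1 A2 B2 (l * C2)" and H: "is_form H"
  shows "hilbert_burch (n + 1) n' F G (l * H) (l * A1) (l * B1) C1 A2 B2 C2"
proof -
  have lH: "int (tdeg (l * H)) = int (tdeg H) + 1"
    using tdeg_mult[OF line_form H] line_tdeg by simp
  have mult: "homogeneous (n + 1 - d) (l * A)" if "homogeneous (n - d) A" for A d
    using homogeneous_mult[OF line_homogeneous that] by (simp add: algebra_simps)
  have div: "homogeneous (n' - (int (tdeg H) + 1)) C2"
    using homogeneous_divide[OF line_homogeneous line_nonzero, of "n' - int (tdeg H)" C2] hb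
    by (simp add: hilbert_burch_def mult.commute algebra_simps)
  have eqs: "B1 * (l * C2) - C1 * B2 = F" "C1 * A2 - A1 * (l * C2) = G" "A1 * B2 - B1 * A2 = H"
    using hb by (auto simp: hilbert_burch_def)
  have "l * B1 * C2 - C1 * B2 = F" "C1 * A2 - l * A1 * C2 = G"
    "l * A1 * B2 - l * B1 * A2 = l * H"
    unfolding eqs[symmetric] by (simp_all add: algebra_simps)
  then show ?thesis
    using hb mult div unfolding hilbert_burch_def lH by (simp add: algebra_simps)
qed

text \<open>Multiplication by \<open>H\<close> identifies \<open>\<langle>F, G, H\<rangle>/\<langle>F, G, l H\<rangle>\<close> with \<open>R/\<langle>l, C1, C2\<rangle> = R/\<langle>l,
  C1\<rangle>\<close>, because the last entries of syzygies are the elements \<open>r\<close> with \<open>r H \<in> \<langle>F, G\<rangle>\<close>. On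
  the line \<open>l = 0\<close> this is \<open>k[t]/t\<^sup>N\<close>, where \<open>N\<close> is the degree of \<open>C1\<close>, with basis the
  powers of \<open>z\<close> below \<open>N\<close>.\<close>

lemma colength_mult_line:
  assumes hb: "hilbert_burch n n' F G H A1 B1 C1 A2 B2 C2" and reg: "regular_pair F G"
    and C: "\<not> l dvd C1" "l dvd C2"
    and D: "has_colength (ideal_gen {F, G, H}) D"
  shows "n \<ge> int (tdeg H)"
    and "has_colength (ideal_gen {F, G, l * H}) (D + nat (n - int (tdeg H)))"
proof -
  define N where "N = nat (n - int (tdeg H))"
  have hom: "homogeneous (n - int (tdeg H)) C1"
    using hb by (simp add: hilbert_burch_def)
  have C10: "C1 \<noteq> 0" using C by auto
  show deg: "n \<ge> int (tdeg H)"
    using homogeneous_negative[OF hom] C10 by fastforce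
  then have "homogeneous (int N) C1" using hom by (simp add: N_def)
  then obtain c where c: "\<rho> C1 = monom c N" using rho_homogeneous by blast
  have c0: "c \<noteq> 0" using C c by (auto simp flip: rho_eq_0_iff)
  let ?I = "ideal_gen {F, G, H}" and ?J = "ideal_gen {F, G, l * H}"
  have sum_eq: "(\<Sum>i<N. smult [:u i:] (H * z ^ i)) = (\<Sum>i<N. [:[:u i:]:] * z ^ i) * H"
    for u :: "nat \<Rightarrow> 'k"
    unfolding sum_distrib_right by (intro sum.cong) (simp_all add: mult.commute)
  have coeff_rho_sum: "coeff (\<rho> (\<Sum>i<N. [:[:u i:]:] * z ^ i)) j = (if j < N then u j else 0)"
    for u :: "nat \<Rightarrow> 'k" and j
    unfolding rho_sum[OF finite_lessThan] rho_mult rho_const rho_power rho_z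
    by (simp add: coeff_sum flip: monom_altdef)
  have sub: "?J \<subseteq> ?I"
    unfolding ideal_gen_triple subset_iff by (metis mult.assoc)
  have "has_colength ?J (D + N)"
  proof (rule has_colength_extend[OF D sub ideal_gen_add ideal_gen_diff])
    show "(\<Sum>i<N. smult [:u i:] (H * z ^ i)) \<in> ?I" for u
      unfolding sum_eq ideal_gen_triple
      by (rule exI[of _ 0], rule exI[of _ 0]) auto
  next
    fix u :: "nat \<Rightarrow> 'k" assume "(\<Sum>i<N. smult [:u i:] (H * z ^ i)) \<in> ?J"
    then obtain A B E where E: "(\<Sum>i<N. [:[:u i:]:] * z ^ i) * H = A * F + B * G + E * (l * H)"
      unfolding sum_eq ideal_gen_triple by blast
    define r where "r = (\<Sum>i<N. [:[:u i:]:] * z ^ i)"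
    have "A * F + B * G + (E * l - r) * H = 0" using E by (simp add: r_def algebra_simps)
    then obtain P Q where PQ: "E * l - r = P * C1 + Q * C2"
      using hilbert_burch_generate[OF hb reg] by blast
    have "\<rho> l = 0" "\<rho> C2 = 0" using C by (auto simp: rho_eq_0_iff)
    then have "\<rho> (E * l) - \<rho> r = \<rho> (P * C1 + Q * C2)" using PQ rho_diff by metis
    then have "\<rho> r = - \<rho> P * monom c N"
      using \<open>\<rho> l = 0\<close> \<open>\<rho> C2 = 0\<close> c by (simp add: rho_mult rho_add minus_equation_iff[of "\<rho> r"])
    then have "coeff (\<rho> r) i = 0" if "i < N" for i
      using that by (auto simp: coeff_mult intro!: sum.neutral)
    then show "\<forall>i<N. u i = 0" using coeff_rho_sum[of u] by (simp add: r_def)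
  next
    fix f assume "f \<in> ?I"
    then obtain A B r where f: "f = A * F + B * G + r * H" unfolding ideal_gen_triple by blast
    define u where "u = (\<lambda>i. coeff (\<rho> r) i)"
    define s where "s = (\<Sum>i<N. [:[:u i:]:] * z ^ i)"
    have "\<forall>k<N. coeff (\<rho> (r - s)) k = 0"
      using coeff_rho_sum[of u] by (simp add: rho_diff s_def u_def)
    then have "monom 1 N dvd \<rho> (r - s)" by (simp add: monom_1_dvd_iff')
    moreover have "monom 1 N = smult (1 / c) (\<rho> C1)" using c0 by (simp add: c smult_monom)
    ultimately have "\<rho> C1 dvd \<rho> (r - s)" using c0 by (simp add: smult_dvd_iff)
    then obtain w where w: "\<rho> (r - s) = \<rho> C1 * w" by (rule dvdE)
    obtain P where "\<rho> P = w" using rho_surj by blast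
    then have "\<rho> (r - s - C1 * P) = 0" using w by (simp add: rho_diff rho_mult)
    then obtain E where E: "r - s - C1 * P = l * E" by (auto simp: rho_eq_0_iff)
    have "C1 * H = - (A1 * F) - B1 * G"
      using hilbert_burch_syzygies(1)[OF hb] by (simp add: algebra_simps eq_neg_iff_add_eq_0)
    then have "f - s * H = (A - P * A1) * F + (B - P * B1) * G + E * (l * H)"
      using E f by algebra
    then have "f - s * H \<in> ?J" unfolding ideal_gen_triple by blast
    then show "\<exists>u. f - (\<Sum>i<N. smult [:u i:] (H * z ^ i)) \<in> ?J"
      unfolding sum_eq s_def by blast
  qed
  then show "has_colength ?J (D + nat (n - int (tdeg H)))" by (simp add: N_def)
qed

end

section \<open>Syzygy degrees for products of linear forms\<close>

text \<open>The Hilbert-Burch matrix and the colength are carried along together, since a single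
  induction over the linear factors of \<open>H\<close> proves both. The formula for \<open>D\<close> says that \<open>4 D =
  2 (f g + f h + g h) - f\<^sup>2 - g\<^sup>2 - h\<^sup>2 + (m - m')\<^sup>2\<close> for the degrees \<open>f\<close>, \<open>g\<close>, \<open>h\<close> of the
  three forms, as \<open>m + m' = f + g + h\<close>.\<close>

definition syzygy_degrees ::
    "int \<Rightarrow> int \<Rightarrow> 'k::field poly poly \<Rightarrow> 'k poly poly \<Rightarrow> 'k poly poly \<Rightarrow> bool" where
  "syzygy_degrees m m' F G H \<longleftrightarrow>
     (\<exists>A1 B1 C1 A2 B2 C2. hilbert_burch m m' F G H A1 B1 C1 A2 B2 C2) \<and>
     (\<exists>D. has_colength (ideal_gen {F, G, H}) D \<and>
       int D = int (tdeg F) * int (tdeg G) + (int (tdeg F) + int (tdeg G)) * int (tdeg H) - m * m')"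

lemma syzygy_degrees_1:
  fixes F G :: "'k::field poly poly"
  assumes "is_form F" "is_form G"
  shows "syzygy_degrees (int (tdeg F)) (int (tdeg G)) F G 1"
proof -
  have "hilbert_burch (int (tdeg F)) (int (tdeg G)) F G 1 1 0 (- F) 0 1 (- G)"
    unfolding hilbert_burch_def using assms by (auto intro: homogeneous_uminus form_homogeneous)
  moreover have "f \<in> ideal_gen {F, G, 1}" for f
    unfolding ideal_gen_triple by (rule exI[of _ 0], rule exI[of _ 0], rule exI[of _ f]) simp
  then have "has_colength (ideal_gen {F, G, 1}) 0"
    unfolding has_colength_def by simp
  ultimately show ?thesis unfolding syzygy_degrees_def by fastforce
qed

lemma syzygy_degrees_mult_line:
  assumes l: "is_form l" "tdeg l = 1" and reg: "regular_pair F G"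
    and forms: "is_form F" "is_form G" "is_form H"
    and deg: "syzygy_degrees m m' F G H"
  shows "syzygy_degrees (m + 1) m' F G (l * H) \<or> syzygy_degrees (m' + 1) m F G (l * H)"
proof -
  obtain \<rho> z where "line_restriction l \<rho> z" using line_restriction_exists[OF l] by blast
  then interpret line_restriction l \<rho> z .
  obtain A1 B1 C1 A2 B2 C2 D where hb: "hilbert_burch m m' F G H A1 B1 C1 A2 B2 C2"
    and D: "has_colength (ideal_gen {F, G, H}) D"
      "int D = int (tdeg F) * int (tdeg G) + (int (tdeg F) + int (tdeg G)) * int (tdeg H) - m * m'"
    using deg unfolding syzygy_degrees_def by blast
  obtain n n' A1 B1 C1 A2 B2 C2 where nn: "n = m \<and> n' = m' \<or> n = m' \<and> n' = m"
    and hb: "hilbert_burch n n' F G H A1 B1 C1 A2 B2 C2" and C: "\<not> l dvd C1" "l dvd C2"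
    using hilbert_burch_reduce[OF hb reg] by blast
  obtain C2' where C2': "C2 = l * C2'" using C by (auto elim: dvdE)
  have "syzygy_degrees (n + 1) n' F G (l * H)"
    unfolding syzygy_degrees_def
  proof (intro conjI)
    show "\<exists>A1 B1 C1 A2 B2 C2. hilbert_burch (n + 1) n' F G (l * H) A1 B1 C1 A2 B2 C2"
      using hilbert_burch_mult_line hb C2' forms(3) by blast
    have sum: "n + n' = int (tdeg F) + int (tdeg G) + int (tdeg H)"
      by (rule hilbert_burch_degree_sum[OF hb reg forms(1,2)])
    have h: "int (tdeg (l * H)) = int (tdeg H) + 1" using tdeg_mult[OF l(1) forms(3)] l(2) by simp
    have mm: "m * m' = n * n'" using nn by auto
    have n: "n = int (tdeg F) + int (tdeg G) + int (tdeg H) - n'" using sum by simp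
    have "int (D + nat (n - int (tdeg H))) = int (tdeg F) * int (tdeg G) +
        (int (tdeg F) + int (tdeg G)) * int (tdeg (l * H)) - (n + 1) * n'"
      using colength_mult_line(1)[OF hb reg C D(1)] unfolding of_nat_add D(2) h mm
      by (simp add: n algebra_simps)
    then show "\<exists>D. has_colength (ideal_gen {F, G, l * H}) D \<and>
        int D = int (tdeg F) * int (tdeg G) + (int (tdeg F) + int (tdeg G)) * int (tdeg (l * H))
          - (n + 1) * n'"
      using colength_mult_line(2)[OF hb reg C D(1)] by blast
  qed
  then show ?thesis using nn by blast
qed

section \<open>Products of powers of linear forms\<close>

lemma linear_form_dvd_mult_iff:
  fixes F G l :: "'k::field poly poly"
  assumes "is_form l" "tdeg l = 1" shows "l dvd F * G \<longleftrightarrow> l dvd F \<or> l dvd G"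
  using line_restriction_exists[OF assms] line_restriction.line_dvd_mult_iff by blast

lemma linear_form_not_unit: "is_form l \<Longrightarrow> tdeg l = 1 \<Longrightarrow> \<not> is_unit l"
  for l :: "'k::field poly poly"
  using line_restriction_exists line_restriction.line_not_unit by blast

lemma linear_form_dvd_power:
  fixes F l :: "'k::field poly poly"
  assumes "is_form l" "tdeg l = 1" "l dvd F ^ n" shows "l dvd F"
  using assms(3)
  by (induction n) (auto simp: linear_form_dvd_mult_iff[OF assms(1,2)] linear_form_not_unit[OF assms(1,2)])

lemma form_power_0 [simp]: "form_power l (\<lambda>i. 0) = 1"
  by (simp add: form_power_def)

lemma form_power_add: "form_power l (\<lambda>i. a i + b i) = form_power l a * form_power l b"
  by (simp add: form_power_def power_add prod.distrib)

lemma form_power_times: "form_power l (\<lambda>i. n * a i) = form_power l a ^ n"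
  unfolding form_power_def prod_power_distrib
  by (intro prod.cong) (simp_all add: mult.commute flip: power_mult)

lemma form_power_Suc: "form_power l (a(i := Suc (a i))) = l i * form_power l a"
proof -
  have "form_power l (a(i := Suc (a i))) = (\<Prod>j\<in>UNIV. (if j = i then l i else 1) * l j ^ a j)"
    unfolding form_power_def by (intro prod.cong) auto
  then show ?thesis by (simp add: prod.distrib form_power_def)
qed

lemma sum_Suc_upd: "(\<Sum>j\<in>UNIV. (a(i := Suc (a i))) j) = Suc (\<Sum>j\<in>UNIV. a j)"
  for a :: "'n::finite \<Rightarrow> nat"
proof -
  have "(\<Sum>j\<in>UNIV. (a(i := Suc (a i))) j) = (\<Sum>j\<in>UNIV. (if j = i then 1 else 0) + a j)"
    by (intro sum.cong) auto
  then show ?thesis by (simp add: sum.distrib)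
qed

lemma exponent_induct [case_names zero Suc]:
  fixes a :: "'n::finite \<Rightarrow> nat"
  assumes zero: "P (\<lambda>i. 0)" and Suc: "\<And>a i. P a \<Longrightarrow> P (a(i := Suc (a i)))"
  shows "P a"
proof (induction "\<Sum>j\<in>UNIV. a j" arbitrary: a)
  case 0
  then have "a = (\<lambda>i. 0)" by auto
  then show ?case using zero by simp
next
  case (Suc n)
  then obtain i where i: "a i > 0" by (metis gr0I sum.neutral nat.distinct(1))
  define b where "b = a(i := a i - 1)"
  have ab: "a = b(i := Suc (b i))" using i by (auto simp: b_def)
  then have "n = (\<Sum>j\<in>UNIV. b j)" using Suc(2) sum_Suc_upd[of b i] by simp
  then show ?case using Suc(1) assms(2) ab by metis
qed

locale line_family =
  fixes l :: "'n::finite \<Rightarrow> 'k::field poly poly"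
  assumes line_form: "is_form (l i)" and line_tdeg: "tdeg (l i) = 1"
begin

lemma form_power_form: "is_form (form_power l a)"
proof (induction a rule: exponent_induct)
  case (Suc a i)
  show ?case unfolding form_power_Suc by (rule is_form_mult[OF line_form Suc])
qed simp

lemma tdeg_form_power: "tdeg (form_power l a) = (\<Sum>i\<in>UNIV. a i)"
proof (induction a rule: exponent_induct)
  case (Suc a i)
  then show ?case
    unfolding form_power_Suc sum_Suc_upd
    by (simp add: tdeg_mult line_form line_tdeg form_power_form)
qed simp

lemma form_power_homogeneous: "homogeneous (int (\<Sum>i\<in>UNIV. a i)) (form_power l a)"
  using form_homogeneous[OF form_power_form[of a]] by (simp only: tdeg_form_power)

lemma form_power_nonzero: "form_power l a \<noteq> 0"
  by (rule form_nonzero[OF form_power_form])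

end

section \<open>The syzygy gap as a function of the exponents\<close>

locale arrangement = line_family l for l :: "'n::finite \<Rightarrow> 'k::field poly poly" +
  fixes F G :: "'k poly poly"
  assumes F_form: "is_form F" and G_form: "is_form G" and regular: "regular_pair F G"
begin

definition gap :: "('n \<Rightarrow> nat) \<Rightarrow> int" where
  "gap a = syzygy_gap F G (form_power l a)"

text \<open>The degree of \<open>F G\<close>, as an integer: it is the degree of the Koszul syzygy \<open>(G, -F,
  0)\<close>.\<close>

definition koszul_degree :: int where
  "koszul_degree = int (tdeg F) + int (tdeg G)"

lemma syzygy_degrees_exist: "\<exists>m m'. syzygy_degrees m m' F G (form_power l a)"
proof (induction a rule: exponent_induct)
  case zero
  then show ?case using syzygy_degrees_1[OF F_form G_form] by auto
next
  case (Suc a i)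
  then show ?case
    unfolding form_power_Suc
    using syzygy_degrees_mult_line[OF line_form line_tdeg regular F_form G_form form_power_form]
    by blast
qed

lemma syzygy_degrees_gap:
  assumes "syzygy_degrees m m' F G (form_power l a)"
  shows "gap a = \<bar>m - m'\<bar>" "m + m' = koszul_degree + int (\<Sum>i\<in>UNIV. a i)"
proof -
  obtain A1 B1 C1 A2 B2 C2 where hb: "hilbert_burch m m' F G (form_power l a) A1 B1 C1 A2 B2 C2"
    using assms unfolding syzygy_degrees_def by blast
  show "gap a = \<bar>m - m'\<bar>"
    unfolding gap_def by (rule syzygy_gap_eq[OF hb regular F_form G_form])
  show "m + m' = koszul_degree + int (\<Sum>i\<in>UNIV. a i)"
    using hilbert_burch_degree_sum[OF hb regular F_form G_form]
    by (simp only: tdeg_form_power koszul_degree_def)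
qed

lemma gap_nonneg: "gap a \<ge> 0"
  using syzygy_degrees_exist[of a] syzygy_degrees_gap(1) by fastforce

lemma gap_Suc: "\<bar>gap (a(i := Suc (a i))) - gap a\<bar> \<le> 1"
proof -
  obtain m m' where m: "syzygy_degrees m m' F G (form_power l a)"
    using syzygy_degrees_exist by blast
  then have "syzygy_degrees (m + 1) m' F G (form_power l (a(i := Suc (a i)))) \<or>
      syzygy_degrees (m' + 1) m F G (form_power l (a(i := Suc (a i))))"
    unfolding form_power_Suc
    by (intro syzygy_degrees_mult_line line_form line_tdeg regular F_form G_form form_power_form)
  then have "gap (a(i := Suc (a i))) = \<bar>m + 1 - m'\<bar> \<or> gap (a(i := Suc (a i))) = \<bar>m' + 1 - m\<bar>"
    using syzygy_degrees_gap(1) by blast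
  then show ?thesis using syzygy_degrees_gap(1)[OF m] by auto
qed

lemma gap_add: "\<bar>gap (\<lambda>i. a i + c i) - gap a\<bar> \<le> int (\<Sum>i\<in>UNIV. c i)"
proof (induction c rule: exponent_induct)
  case (Suc c i)
  have "(\<lambda>j. a j + (c(i := Suc (c i))) j) = (\<lambda>j. a j + c j)(i := Suc (a i + c i))" by auto
  then show ?case using Suc gap_Suc[of "\<lambda>j. a j + c j" i] unfolding sum_Suc_upd by simp
qed simp

lemma gap_lipschitz: "\<bar>gap a - gap b\<bar> \<le> (\<Sum>i\<in>UNIV. \<bar>int (a i) - int (b i)\<bar>)"
proof -
  have ab: "(\<lambda>i. a i + (b i - a i)) = (\<lambda>i. b i + (a i - b i))" by auto
  have "\<bar>gap a - gap b\<bar> \<le> int (\<Sum>i\<in>UNIV. b i - a i) + int (\<Sum>i\<in>UNIV. a i - b i)"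
    using gap_add[of a "\<lambda>i. b i - a i"] gap_add[of b "\<lambda>i. a i - b i"] unfolding ab by linarith
  also have "\<dots> = (\<Sum>i\<in>UNIV. int (b i - a i) + int (a i - b i))"
    by (simp add: sum.distrib)
  also have "\<dots> = (\<Sum>i\<in>UNIV. \<bar>int (a i) - int (b i)\<bar>)"
    by (intro sum.cong) auto
  finally show ?thesis .
qed

text \<open>By the degree sum, the gap is \<open>deg (F G H) - 2 e\<close> for the least degree \<open>e\<close> of a
  nonzero syzygy, so each syzygy bounds the gap from below; the least degree being attained,
  upper bounds for the gap are lower bounds for the degrees of all nonzero syzygies.\<close>

lemma gap_ge_of_syzygy:
  assumes "homogeneous_syzygy F G (form_power l a) e A B C"
  shows "gap a \<ge> koszul_degree + int (\<Sum>i\<in>UNIV. a i) - 2 * e"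
proof -
  obtain m m' where m: "syzygy_degrees m m' F G (form_power l a)"
    using syzygy_degrees_exist by blast
  then obtain A1 B1 C1 A2 B2 C2 where hb: "hilbert_burch m m' F G (form_power l a) A1 B1 C1 A2 B2 C2"
    unfolding syzygy_degrees_def by blast
  have "min m m' \<le> e"
    by (rule resolution_syzygies(3)[OF hilbert_burch_resolution[OF hb regular] assms])
  then show ?thesis using syzygy_degrees_gap[OF m] by (auto simp: min_def split: if_splits)
qed

lemma gap_attained:
  "\<exists>e A B C. homogeneous_syzygy F G (form_power l a) e A B C \<and>
     gap a = koszul_degree + int (\<Sum>i\<in>UNIV. a i) - 2 * e"
proof -
  obtain m m' where m: "syzygy_degrees m m' F G (form_power l a)"
    using syzygy_degrees_exist by blast
  then obtain A1 B1 C1 A2 B2 C2 where hb: "hilbert_burch m m' F G (form_power l a) A1 B1 C1 A2 B2 C2"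
    unfolding syzygy_degrees_def by blast
  have "\<exists>A B C. homogeneous_syzygy F G (form_power l a) (min m m') A B C"
    using resolution_syzygies(1,2)[OF hilbert_burch_resolution[OF hb regular]]
    by (simp add: min_def)
  moreover have "gap a = koszul_degree + int (\<Sum>i\<in>UNIV. a i) - 2 * min m m'"
    using syzygy_degrees_gap[OF m] by (auto simp: min_def)
  ultimately show ?thesis by blast
qed

lemma gap_ge: "gap a \<ge> int (\<Sum>i\<in>UNIV. a i) - koszul_degree"
proof -
  have "homogeneous_syzygy F G (form_power l a) koszul_degree G (- F) 0"
    unfolding homogeneous_syzygy_def koszul_degree_def
    using form_homogeneous[OF F_form] form_homogeneous[OF G_form] form_nonzero[OF F_form]
    by (simp add: homogeneous_uminus)
  from gap_ge_of_syzygy[OF this] show ?thesis by simp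
qed

text \<open>A nonzero syzygy has either a nonzero last entry, and then degree at least \<open>deg H\<close>, or
  is a multiple of the Koszul syzygy.\<close>

lemma gap_le: "gap a \<le> \<bar>koszul_degree - int (\<Sum>i\<in>UNIV. a i)\<bar>"
proof -
  define s where "s = int (\<Sum>i\<in>UNIV. a i)"
  obtain e A B C where syz: "homogeneous_syzygy F G (form_power l a) e A B C"
    and e: "gap a = koszul_degree + s - 2 * e"
    using gap_attained[of a] by (auto simp: s_def)
  have hom: "homogeneous (e - int (tdeg F)) A" "homogeneous (e - s) C"
    and eq: "A * F + B * G + C * form_power l a = 0" and nz: "A \<noteq> 0 \<or> B \<noteq> 0 \<or> C \<noteq> 0"
    using syz by (auto simp: homogeneous_syzygy_def tdeg_form_power s_def)
  have "e \<ge> s \<or> e \<ge> koszul_degree"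
  proof (cases "C = 0")
    case True
    then have "A * F + B * G = 0" using eq by simp
    then obtain W where W: "A = W * G" "B = - W * F" using regular_pair_syzygy[OF regular] by blast
    have "homogeneous (e - int (tdeg F) - int (tdeg G)) W"
      using hom(1) unfolding W
      by (rule homogeneous_divide[OF form_homogeneous[OF G_form] form_nonzero[OF G_form]])
    moreover have "W \<noteq> 0" using W nz True by auto
    ultimately have "e - int (tdeg F) - int (tdeg G) \<ge> 0" using homogeneous_negative not_le by blast
    then show ?thesis by (simp add: koszul_degree_def)
  next
    case False
    then have "e - s \<ge> 0" using homogeneous_negative[OF hom(2)] not_le by blast
    then show ?thesis by simp
  qed
  then show ?thesis using e unfolding s_def[symmetric] by linarith
qed

lemma colength_gap:
  "4 * int (ideal_deg (ideal_gen {F, G, form_power l a})) =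
     4 * (int (tdeg F) * int (tdeg G)) + (gap a)\<^sup>2 - (koszul_degree - int (\<Sum>i\<in>UNIV. a i))\<^sup>2"
proof -
  define s where "s = int (\<Sum>i\<in>UNIV. a i)"
  obtain m m' where m: "syzygy_degrees m m' F G (form_power l a)"
    using syzygy_degrees_exist by blast
  then obtain D where D: "has_colength (ideal_gen {F, G, form_power l a}) D"
    "int D = int (tdeg F) * int (tdeg G) + koszul_degree * s - m * m'"
    unfolding syzygy_degrees_def tdeg_form_power koszul_degree_def s_def by blast
  have g: "gap a = \<bar>m - m'\<bar>" "koszul_degree = m + m' - s"
    using syzygy_degrees_gap[OF m] by (auto simp: s_def)
  have "4 * int D = 4 * (int (tdeg F) * int (tdeg G)) + (gap a)\<^sup>2 - (koszul_degree - s)\<^sup>2"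
    unfolding D(2) g by (simp add: power2_eq_square algebra_simps)
  then show ?thesis using ideal_deg_eq[OF D(1)] by (simp add: s_def)
qed

text \<open>A syzygy of degree less than \<open>deg H\<close> has last entry \<open>0\<close>. If the basis contains one,
  then \<open>F\<close> and \<open>G\<close> are multiples of \<open>C2\<close>, which is therefore a unit, and \<open>H\<close> lies in \<open>\<langle>F,
  G\<rangle>\<close>.\<close>

lemma large_exponent:
  assumes "int (\<Sum>i\<in>UNIV. a i) > koszul_degree"
  shows "gap a = int (\<Sum>i\<in>UNIV. a i) - koszul_degree"
    and "ideal_gen {F, G, form_power l a} = ideal_gen {F, G}"
proof -
  define s where "s = int (\<Sum>i\<in>UNIV. a i)"
  let ?H = "form_power l a"
  have H: "int (tdeg ?H) = s" by (simp add: s_def tdeg_form_power)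
  obtain m m' where m: "syzygy_degrees m m' F G ?H"
    using syzygy_degrees_exist by blast
  then obtain A1 B1 C1 A2 B2 C2 where hb: "hilbert_burch m m' F G ?H A1 B1 C1 A2 B2 C2"
    unfolding syzygy_degrees_def by blast
  have sum: "m + m' = koszul_degree + s" using syzygy_degrees_gap[OF m] by (simp add: s_def)
  have key: "n' = s \<and> ?H \<in> ideal_gen {F, G}"
    if hb: "hilbert_burch n n' F G ?H A1 B1 C1 A2 B2 C2" and n: "n < s"
    for n n' A1 B1 C1 A2 B2 C2
  proof -
    have hom: "homogeneous (n - s) C1" "homogeneous (n' - s) C2"
      using hb H by (auto simp: hilbert_burch_def)
    have C1: "C1 = 0" using homogeneous_negative[OF hom(1)] n by simp
    have FG: "F = B1 * C2" "G = - A1 * C2" using hb C1 by (auto simp: hilbert_burch_def)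
    then have "is_unit C2" by (intro regular_pair_no_common_factor[OF regular]) auto
    then obtain c where c: "c \<noteq> 0" "C2 = [:[:c:]:]" using is_unit_poly_poly by blast
    have "n' - s = 0"
      using homogeneous_unique[OF hom(2)] c by (metis homogeneous_const pCons_eq_0_iff)
    moreover have "A2 * F + B2 * G + C2 * ?H = 0" by (rule hilbert_burch_syzygies(2)[OF hb])
    then have "C2 * ?H = (- A2) * F + (- B2) * G" by (simp add: eq_neg_iff_add_eq_0 algebra_simps)
    then have "C2 * ?H \<in> ideal_gen {F, G}" unfolding ideal_gen_pair by blast
    then have "[:[:1 / c:]:] * (C2 * ?H) \<in> ideal_gen {F, G}" by (rule ideal_gen_mult)
    moreover have "[:[:1 / c:]:] * (C2 * ?H) = ?H" using c by simp
    ultimately show ?thesis by simp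
  qed
  have "(m = s \<or> m' = s) \<and> ?H \<in> ideal_gen {F, G}"
  proof (cases "m < s")
    case True then show ?thesis using key[OF hb] by blast
  next
    case False
    then have "m' < s" using sum assms by (simp add: s_def)
    then show ?thesis using key[OF hilbert_burch_swap[OF hb]] by blast
  qed
  then have ms: "m = s \<or> m' = s" and HI: "?H \<in> ideal_gen {F, G}" by auto
  show "gap a = int (\<Sum>i\<in>UNIV. a i) - koszul_degree"
    using ms sum assms syzygy_degrees_gap(1)[OF m] by (auto simp: s_def)
  obtain P Q where PQ: "?H = P * F + Q * G" using HI unfolding ideal_gen_pair by blast
  show "ideal_gen {F, G, ?H} = ideal_gen {F, G}"
  proof (intro set_eqI iffI)
    fix f assume "f \<in> ideal_gen {F, G, ?H}"
    then obtain A B C where "f = A * F + B * G + C * ?H" unfolding ideal_gen_triple by blast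
    then have "f = (A + C * P) * F + (B + C * Q) * G" unfolding PQ by (simp add: algebra_simps)
    then show "f \<in> ideal_gen {F, G}" unfolding ideal_gen_pair by blast
  next
    fix f assume "f \<in> ideal_gen {F, G}"
    then obtain A B where "f = A * F + B * G + 0 * ?H" unfolding ideal_gen_pair by auto
    then show "f \<in> ideal_gen {F, G, ?H}" unfolding ideal_gen_triple by blast
  qed
qed

text \<open>Bezout's theorem, read off from the colength formula for an exponent so large that
  \<open>l\<^sup>a \<in> \<langle>F, G\<rangle>\<close>.\<close>

lemma ideal_deg_pair: "ideal_deg (ideal_gen {F, G}) = tdeg F * tdeg G"
proof -
  define a where "a = (\<lambda>i :: 'n. Suc (tdeg F + tdeg G))"
  have "(\<Sum>i\<in>UNIV. a i) = CARD('n) * Suc (tdeg F + tdeg G)" by (simp add: a_def)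
  moreover have "CARD('n) \<ge> 1" by (simp add: Suc_leI)
  ultimately have "(\<Sum>i\<in>UNIV. a i) \<ge> Suc (tdeg F + tdeg G)"
    by (metis mult_le_mono1 nat_mult_1)
  then have big: "int (\<Sum>i\<in>UNIV. a i) > koszul_degree" unfolding koszul_degree_def by linarith
  have "4 * int (ideal_deg (ideal_gen {F, G})) = 4 * (int (tdeg F) * int (tdeg G))"
    using colength_gap[of a] large_exponent[OF big] by (simp add: power2_commute)
  then have "int (ideal_deg (ideal_gen {F, G})) = int (tdeg F * tdeg G)" by simp
  then show ?thesis by (simp only: of_nat_eq_iff)
qed

lemma power_arrangement: "arrangement l (F ^ n) (G ^ n)"
  by unfold_locales (intro is_form_power F_form G_form regular_pair_power[OF regular])+

text \<open>Frobenius is a ring homomorphism, so the minors of the matrix of \<open>q\<close>-th powers are the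
  \<open>q\<close>-th powers of the minors.\<close>

lemma gap_frobenius:
  assumes char: "prime CHAR('k)"
  shows "arrangement.gap l (F ^ (CHAR('k) ^ e)) (G ^ (CHAR('k) ^ e)) (\<lambda>i. CHAR('k) ^ e * a i)
     = int (CHAR('k) ^ e) * gap a"
proof -
  define q where "q = CHAR('k) ^ e"
  interpret Q: arrangement l "F ^ q" "G ^ q" by (rule power_arrangement)
  obtain m m' where m: "syzygy_degrees m m' F G (form_power l a)"
    using syzygy_degrees_exist by blast
  then obtain A1 B1 C1 A2 B2 C2 where hb: "hilbert_burch m m' F G (form_power l a) A1 B1 C1 A2 B2 C2"
    unfolding syzygy_degrees_def by blast
  have dream: "(P - R) ^ q = P ^ q - R ^ q" for P R :: "'k poly poly"
  proof -
    have "P ^ q = (P - R) ^ q + R ^ q"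
      using freshmans_dream'[where x = "P - R" and y = R and m = q and n = e] char by (simp add: q_def)
    then show ?thesis by simp
  qed
  have pow: "homogeneous (int q * d - int q * int n) (P ^ q)" if "homogeneous (d - int n) P"
    for d n and P :: "'k poly poly"
    using homogeneous_power[OF that, of q] by (simp add: right_diff_distrib)
  have deg: "tdeg (F ^ q) = q * tdeg F" "tdeg (G ^ q) = q * tdeg G"
    "tdeg (form_power l a ^ q) = q * tdeg (form_power l a)"
    by (simp_all add: tdeg_power F_form G_form form_power_form)
  have "hilbert_burch (int q * m) (int q * m') (F ^ q) (G ^ q) (form_power l a ^ q)
      (A1 ^ q) (B1 ^ q) (C1 ^ q) (A2 ^ q) (B2 ^ q) (C2 ^ q)"
    using hb unfolding hilbert_burch_def deg of_nat_mult
    by (elim conjE, intro conjI pow; assumption?) (simp_all only: flip: power_mult_distrib dream)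
  then have "Q.gap (\<lambda>i. q * a i) = \<bar>int q * m - int q * m'\<bar>"
    unfolding Q.gap_def form_power_times
    by (rule syzygy_gap_eq) (rule Q.regular Q.F_form Q.G_form)+
  then show ?thesis
    unfolding q_def[symmetric] syzygy_degrees_gap(1)[OF m]
    by (simp add: abs_mult flip: right_diff_distrib)
qed

section \<open>Minimal exponents in the ideal\<close>

text \<open>A maximal gap means that the least degree of a syzygy is \<open>deg H\<close>. The last entry of
  that syzygy is then a constant, nonzero because the Koszul syzygy has larger degree.\<close>

lemma exponent_in_ideal:
  assumes gap: "gap a = koszul_degree - int (\<Sum>i\<in>UNIV. a i)" and small: "int (\<Sum>i\<in>UNIV. a i) < koszul_degree"
  shows "form_power l a \<in> ideal_gen {F, G}"
proof -
  define s where "s = int (\<Sum>i\<in>UNIV. a i)"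
  obtain e A B C where syz: "homogeneous_syzygy F G (form_power l a) e A B C"
    and e: "gap a = koszul_degree + s - 2 * e"
    using gap_attained[of a] by (auto simp: s_def)
  have es: "e = s" using e gap by (simp add: s_def)
  have hom: "homogeneous (s - int (tdeg F)) A" "homogeneous 0 C"
    and eq: "A * F + B * G + C * form_power l a = 0" and nz: "A \<noteq> 0 \<or> B \<noteq> 0 \<or> C \<noteq> 0"
    using syz by (auto simp: homogeneous_syzygy_def es tdeg_form_power s_def)
  obtain c where c: "C = [:[:c:]:]" using homogeneous_0_const[OF hom(2)] by blast
  have "c \<noteq> 0"
  proof
    assume "c = 0"
    then have "A * F + B * G = 0" and AB: "A \<noteq> 0 \<or> B \<noteq> 0" using eq nz c by auto
    then obtain W where W: "A = W * G" "B = - W * F" using regular_pair_syzygy[OF regular] by blast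
    have "homogeneous (s - int (tdeg F) - int (tdeg G)) W"
      using hom(1) unfolding W
      by (rule homogeneous_divide[OF form_homogeneous[OF G_form] form_nonzero[OF G_form]])
    then have "W = 0" using small by (elim homogeneous_negative) (simp add: s_def koszul_degree_def)
    then show False using AB W by simp
  qed
  have "C * form_power l a = (- A) * F + (- B) * G" using eq by (simp add: eq_neg_iff_add_eq_0 algebra_simps)
  then have "C * form_power l a \<in> ideal_gen {F, G}" unfolding ideal_gen_pair by blast
  then have "[:[:1 / c:]:] * (C * form_power l a) \<in> ideal_gen {F, G}" by (rule ideal_gen_mult)
  moreover have "[:[:1 / c:]:] * (C * form_power l a) = form_power l a" using c \<open>c \<noteq> 0\<close> by simp
  ultimately show ?thesis by simp
qed

lemma homogeneous_cofactors:
  assumes "form_power l b \<in> ideal_gen {F, G}"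
  defines "s \<equiv> int (\<Sum>i\<in>UNIV. b i)"
  shows "\<exists>A B. homogeneous (s - int (tdeg F)) A \<and> homogeneous (s - int (tdeg G)) B \<and>
    form_power l b = A * F + B * G"
proof -
  obtain A B where AB: "form_power l b = A * F + B * G" using assms unfolding ideal_gen_pair by blast
  have H: "homogeneous s (form_power l b)" unfolding s_def by (rule form_power_homogeneous)
  have "form_power l b = hcomp s (A * F + B * G)" using hcomp_homogeneous[OF H] AB by simp
  also have "\<dots> = hcomp (s - int (tdeg F)) A * F + hcomp (s - int (tdeg G)) B * G"
    by (simp add: hcomp_add hcomp_mult[OF form_homogeneous] F_form G_form)
  finally show ?thesis using homogeneous_hcomp by blast
qed

lemma gap_of_exponent_in_ideal:
  assumes "form_power l b \<in> ideal_gen {F, G}"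
  shows "gap b \<ge> koszul_degree - int (\<Sum>i\<in>UNIV. b i)"
proof -
  define s where "s = int (\<Sum>i\<in>UNIV. b i)"
  obtain A B where hom: "homogeneous (s - int (tdeg F)) A" "homogeneous (s - int (tdeg G)) B"
    and AB: "form_power l b = A * F + B * G"
    using homogeneous_cofactors[OF assms] unfolding s_def by blast
  have "homogeneous 0 (- 1 :: 'k poly poly)" by (intro homogeneous_uminus homogeneous_1)
  moreover have "s - int (tdeg (form_power l b)) = 0" by (simp add: tdeg_form_power s_def)
  moreover have "A * F + B * G + - 1 * form_power l b = 0" unfolding AB by simp
  ultimately have "homogeneous_syzygy F G (form_power l b) s A B (- 1)"
    using hom unfolding homogeneous_syzygy_def by simp
  from gap_ge_of_syzygy[OF this] show ?thesis by (simp add: s_def)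
qed

text \<open>If \<open>l i\<close> divided both cofactors, it could be cancelled from \<open>l\<^sup>b\<close>, against minimality
  of \<open>b\<close>.\<close>

lemma minimal_exponent:
  assumes "form_power l a \<in> ideal_gen {F, G}"
  obtains b A B where "\<And>i. b i \<le> a i" "form_power l b = A * F + B * G"
    "homogeneous (int (\<Sum>i\<in>UNIV. b i) - int (tdeg F)) A"
    "\<And>i. b i > 0 \<Longrightarrow> \<not> (l i dvd A \<and> l i dvd B)"
proof -
  define P where "P = (\<lambda>b :: 'n \<Rightarrow> nat. (\<forall>i. b i \<le> a i) \<and> form_power l b \<in> ideal_gen {F, G})"
  have "P a" using assms by (simp add: P_def)
  then obtain b where b: "P b" and least: "\<And>b'. P b' \<Longrightarrow> (\<Sum>i\<in>UNIV. b i) \<le> (\<Sum>i\<in>UNIV. b' i)"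
    using ex_has_least_nat[of P a "\<lambda>b. \<Sum>i\<in>UNIV. b i"] by blast
  obtain A B where AB: "form_power l b = A * F + B * G"
    and hom: "homogeneous (int (\<Sum>i\<in>UNIV. b i) - int (tdeg F)) A"
    using b homogeneous_cofactors unfolding P_def by blast
  have "\<not> (l i dvd A \<and> l i dvd B)" if i: "b i > 0" for i
  proof
    assume "l i dvd A \<and> l i dvd B"
    then obtain A' B' where A'B': "A = l i * A'" "B = l i * B'" by (auto elim!: dvdE)
    define b' where "b' = b(i := b i - 1)"
    have bb': "b = b'(i := Suc (b' i))" using i by (auto simp: b'_def)
    then have "l i * form_power l b' = l i * (A' * F + B' * G)"
      using AB form_power_Suc[of l b' i] unfolding A'B' by (simp add: algebra_simps)
    then have "form_power l b' = A' * F + B' * G" using form_nonzero[OF line_form] by simp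
    moreover have "b' j \<le> a j" for j using b i unfolding P_def b'_def
      by (metis diff_le_self fun_upd_apply le_trans)
    ultimately have "P b'" unfolding P_def ideal_gen_pair by blast
    then have "(\<Sum>i\<in>UNIV. b i) \<le> (\<Sum>i\<in>UNIV. b' i)" by (rule least)
    then show False using sum_Suc_upd[of b' i] bb' by simp
  qed
  then show thesis using that[of b A B] b AB hom unfolding P_def by blast
qed

text \<open>Each factor \<open>l i\<close> of \<open>l\<^sup>r\<close> is a prime that divides neither \<open>l\<^sup>s\<close> nor both of \<open>A\<close> and
  \<open>B\<close>, so it must come from \<open>C\<close>.\<close>

lemma form_power_dvd_cancel:
  assumes coprime: "\<And>i j. i \<noteq> j \<Longrightarrow> coprime (l i) (l j)"
    and AB: "\<And>i. r i > 0 \<Longrightarrow> \<not> (l i dvd A \<and> l i dvd B)"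
    and disj: "\<And>i. r i > 0 \<Longrightarrow> s i = 0"
    and dvd: "form_power l r dvd C * form_power l s * A ^ n"
      "form_power l r dvd C * form_power l s * B ^ n"
  shows "form_power l r dvd C"
  using AB disj dvd
proof (induction r rule: exponent_induct)
  case (Suc r i)
  let ?S = "form_power l s"
  have sub: "form_power l r dvd form_power l (r(i := Suc (r i)))"
    unfolding form_power_Suc by (rule dvd_triv_right)
  have "form_power l r dvd C"
  proof (rule Suc.IH)
    show "\<not> (l j dvd A \<and> l j dvd B)" "s j = 0" if "r j > 0" for j
      using Suc.prems(1,2)[of j] that by (cases "j = i"; simp)+
    show "form_power l r dvd C * ?S * A ^ n" "form_power l r dvd C * ?S * B ^ n"
      using dvd_trans[OF sub] Suc.prems(3,4) by blast+
  qed
  then obtain E where E: "C = form_power l r * E" by (rule dvdE)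
  have nz: "form_power l r \<noteq> 0" by (rule form_power_nonzero)
  have "l i dvd E * ?S * A ^ n" "l i dvd E * ?S * B ^ n"
    using Suc.prems(3,4) nz unfolding form_power_Suc E
    by (metis (no_types, lifting) dvd_mult_cancel_left mult.assoc mult.commute)+
  moreover have "\<not> l i dvd ?S"
  proof
    assume "l i dvd ?S"
    moreover have "l i dvd (\<Prod>j\<in>J. l j ^ s j) \<Longrightarrow> \<exists>j\<in>J. l i dvd l j ^ s j" if "finite J" for J
      using that
      by (induction J)
        (auto simp: linear_form_dvd_mult_iff[OF line_form line_tdeg] linear_form_not_unit[OF line_form line_tdeg])
    ultimately obtain j where j: "l i dvd l j ^ s j" unfolding form_power_def by auto
    then have "s j > 0" using linear_form_not_unit[OF line_form line_tdeg] by (cases "s j") auto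
    then have "i \<noteq> j" using Suc.prems(2)[of i] by auto
    from coprime[OF this] have "is_unit (l i)"
      by (rule coprime_common_divisor) (simp_all add: linear_form_dvd_power[OF line_form line_tdeg j])
    then show False using linear_form_not_unit[OF line_form line_tdeg] by blast
  qed
  moreover have "\<not> (l i dvd A \<and> l i dvd B)" using Suc.prems(1)[of i] by simp
  ultimately have "l i dvd E"
    using linear_form_dvd_mult_iff[OF line_form line_tdeg] linear_form_dvd_power[OF line_form line_tdeg] by meson
  then show ?case unfolding form_power_Suc E by (simp add: mult.commute mult_dvd_mono)
qed simp

text \<open>The key estimate: around a minimal exponent \<open>b\<close> the gap falls at least as fast as the
  distance grows, at every Frobenius level. Raising \<open>l\<^sup>b = A F + B G\<close> to the power \<open>Q\<close> gives
  a syzygy for the exponent \<open>Q b\<close>. A syzygy for another exponent \<open>c\<close>, transported to a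
  common exponent, either is a multiple of it, and then its degree is bounded below since
  minimality of \<open>b\<close> leaves no common linear factor to cancel, or differs from such a
  multiple by a nonzero Koszul syzygy, which has degree at least \<open>deg (F\<^sup>Q G\<^sup>Q)\<close>.\<close>

lemma gap_le_near_minimal_exponent:
  assumes char: "prime CHAR('k)" and coprime: "\<And>i j. i \<noteq> j \<Longrightarrow> coprime (l i) (l j)"
    and eq: "form_power l b = A * F + B * G"
    and hom: "homogeneous (int (\<Sum>i\<in>UNIV. b i) - int (tdeg F)) A"
    and AB: "\<And>i. b i > 0 \<Longrightarrow> \<not> (l i dvd A \<and> l i dvd B)"
    and Q: "Q = CHAR('k) ^ e"
  shows "arrangement.gap l (F ^ Q) (G ^ Q) c \<le>
    \<bar>int Q * (koszul_degree - int (\<Sum>i\<in>UNIV. b i)) - (\<Sum>i\<in>UNIV. \<bar>int (c i) - int (Q * b i)\<bar>)\<bar>"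
proof -
  interpret Q: arrangement l "F ^ Q" "G ^ Q" by (rule power_arrangement)
  define r where "r = (\<lambda>i. Q * b i - c i)"
  define s where "s = (\<lambda>i. c i - Q * b i)"
  have rs: "c i + r i = Q * b i + s i" for i by (simp add: r_def s_def)
  define nb nc nr ns where "nb = int (\<Sum>i\<in>UNIV. b i)" and "nc = int (\<Sum>i\<in>UNIV. c i)"
    and "nr = int (\<Sum>i\<in>UNIV. r i)" and "ns = int (\<Sum>i\<in>UNIV. s i)"
  have "nc + nr = (\<Sum>i\<in>UNIV. int (c i + r i))" by (simp add: nc_def nr_def sum.distrib)
  also have "\<dots> = int Q * nb + ns" unfolding rs by (simp add: nb_def ns_def sum.distrib sum_distrib_left)
  finally have sum: "nc + nr = int Q * nb + ns" .
  have dist: "(\<Sum>i\<in>UNIV. \<bar>int (c i) - int (Q * b i)\<bar>) = nr + ns"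
  proof -
    have "\<bar>int i - int j\<bar> = int (j - i) + int (i - j)" for i j by simp
    then show ?thesis
      unfolding nr_def ns_def of_nat_sum sum.distrib[symmetric] by (simp only: r_def s_def)
  qed
  have koszul_degree: "Q.koszul_degree = int Q * koszul_degree"
    by (simp add: Q.koszul_degree_def koszul_degree_def tdeg_power F_form G_form algebra_simps)
  obtain d A' B' C' where syz: "homogeneous_syzygy (F ^ Q) (G ^ Q) (form_power l c) d A' B' C'"
    and gap: "Q.gap c = int Q * koszul_degree + nc - 2 * d"
    using Q.gap_attained[of c] by (auto simp: koszul_degree nc_def)
  have homA: "homogeneous (d - int (Q * tdeg F)) A'" and homC: "homogeneous (d - nc) C'"
    and syz0: "A' * F ^ Q + B' * G ^ Q + C' * form_power l c = 0"
    and nz: "A' \<noteq> 0 \<or> B' \<noteq> 0 \<or> C' \<noteq> 0"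
    using syz by (auto simp: homogeneous_syzygy_def tdeg_power F_form G_form tdeg_form_power nc_def)
  let ?R = "form_power l r" and ?S = "form_power l s"
  have shift: "form_power l c * ?R = form_power l b ^ Q * ?S"
    using form_power_add[of l c r] form_power_add[of l "\<lambda>i. Q * b i" s]
    by (simp add: rs form_power_times)
  have pow: "form_power l b ^ Q = A ^ Q * F ^ Q + B ^ Q * G ^ Q"
    unfolding eq using freshmans_dream'[where x = "A * F" and y = "B * G" and m = Q and n = e] char Q
    by (simp add: power_mult_distrib)
  \<comment> \<open>For the third form \<open>l\<^sup>c l\<^sup>r = l\<^sup>Q\<^sup>b l\<^sup>s\<close> both \<open>(A' l\<^sup>r, B' l\<^sup>r, C')\<close> and
    \<open>(A\<^sup>Q l\<^sup>s, B\<^sup>Q l\<^sup>s, -1)\<close> are syzygies; this combination eliminates the third entry.\<close>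
  define X where "X = A' * ?R + C' * ?S * A ^ Q"
  define Y where "Y = B' * ?R + C' * ?S * B ^ Q"
  have "X * F ^ Q + Y * G ^ Q = (A' * F ^ Q + B' * G ^ Q) * ?R + C' * (form_power l b ^ Q * ?S)"
    unfolding X_def Y_def pow by (simp add: algebra_simps)
  also have "\<dots> = (A' * F ^ Q + B' * G ^ Q + C' * form_power l c) * ?R"
    unfolding shift[symmetric] by (simp add: algebra_simps)
  finally have "X * F ^ Q + Y * G ^ Q = 0" using syz0 by simp
  then obtain W where W: "X = W * G ^ Q" "Y = - W * F ^ Q"
    using regular_pair_syzygy[OF Q.regular] by blast
  have bound: "d \<ge> int Q * koszul_degree - nr \<or> d \<ge> int Q * nb + ns"
  proof (cases "W = 0")
    case False
    have "homogeneous (d - int (Q * tdeg F) + nr) (A' * ?R)"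
      unfolding nr_def by (intro homogeneous_mult homA form_power_homogeneous)
    moreover have "homogeneous (d - nc + ns + int Q * (nb - int (tdeg F))) (C' * ?S * A ^ Q)"
      unfolding ns_def nb_def
      by (intro homogeneous_mult homC form_power_homogeneous homogeneous_power hom)
    moreover have "d - nc + ns + int Q * (nb - int (tdeg F)) = d - int (Q * tdeg F) + nr"
      using sum by (simp add: algebra_simps)
    ultimately have "homogeneous (d - int (Q * tdeg F) + nr) X"
      unfolding X_def by (metis homogeneous_add)
    then have "homogeneous (d - int (Q * tdeg F) + nr - int (tdeg (G ^ Q))) W"
      unfolding W
      by (intro homogeneous_divide[OF form_homogeneous[OF Q.G_form] form_nonzero[OF Q.G_form]])
    then have "d - int (Q * tdeg F) + nr - int (tdeg (G ^ Q)) \<ge> 0"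
      using False homogeneous_negative by fastforce
    then show ?thesis by (simp add: tdeg_power G_form koszul_degree_def algebra_simps)
  next
    case True
    then have XY: "A' * ?R = - (C' * ?S * A ^ Q)" "B' * ?R = - (C' * ?S * B ^ Q)"
      using W by (simp_all add: X_def Y_def eq_neg_iff_add_eq_0)
    have C'0: "C' \<noteq> 0"
    proof
      assume "C' = 0"
      then show False using XY nz form_power_nonzero[of r] by simp
    qed
    have "?R dvd C'"
    proof (rule form_power_dvd_cancel[OF coprime])
      show "?R dvd C' * ?S * A ^ Q" "?R dvd C' * ?S * B ^ Q"
        using XY by (metis dvd_minus_iff dvd_triv_right)+
      fix i assume r: "r i > 0"
      then show "s i = 0" by (simp add: r_def s_def)
      from r have "b i > 0" by (cases "b i") (auto simp: r_def)
      then show "\<not> (l i dvd A \<and> l i dvd B)" by (rule AB)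
    qed
    then obtain E where E: "C' = E * ?R" by (metis dvdE mult.commute)
    have "homogeneous (d - nc - nr) E"
      using homC unfolding E nr_def
      by (rule homogeneous_divide[OF form_power_homogeneous form_power_nonzero])
    then have "d - nc - nr \<ge> 0" using C'0 E homogeneous_negative by fastforce
    then show ?thesis using sum by linarith
  qed
  then show ?thesis
    unfolding gap dist using sum unfolding nb_def[symmetric] by (simp add: algebra_simps) linarith
qed

end

section \<open>Existence of \<open>\<Delta>\<close> and \<open>\<Phi>\<close>, and the upper region\<close>

lemma l1norm_nonneg: "l1norm x \<ge> 0"
  by (simp add: l1norm_def sum_nonneg)

lemma l1norm_orthant: "x \<in> orthant \<Longrightarrow> l1norm x = (\<Sum>i\<in>UNIV. x $ i)"
  by (simp add: l1norm_def orthant_def)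

lemma l1norm_le_norm: "l1norm x \<le> real CARD('n) * norm x" for x :: "real ^ 'n::finite"
  unfolding l1norm_def using sum_bounded_above[of UNIV "\<lambda>i. \<bar>x $ i\<bar>" "norm x"]
  by (simp add: component_le_norm_cart)

lemma norm_le_l1norm: "norm x \<le> l1norm x" for x :: "real ^ 'n::finite"
  unfolding l1norm_def by (rule norm_le_l1_cart)

lemma l1norm_minus_commute: "l1norm (x - y) = l1norm (y - x)" for x y :: "real ^ 'n::finite"
  by (simp add: l1norm_def abs_minus_commute)

lemma continuous_l1norm [continuous_intros]:
  "continuous_on S f \<Longrightarrow> continuous_on S (\<lambda>x. l1norm (f x))"
  for f :: "'a::topological_space \<Rightarrow> real ^ 'n::finite"
  unfolding l1norm_def by (intro continuous_intros)

lemma l1norm_diff_of_le: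
  fixes s t :: "real ^ 'n::finite"
  assumes "s \<in> orthant" "s \<le> t" shows "l1norm (t - s) = l1norm t - l1norm s"
proof -
  have "t \<in> orthant" using assms by (auto simp: orthant_def less_eq_vec_def intro: order_trans)
  then show ?thesis
    using assms(2) unfolding l1norm_orthant[OF assms(1)] l1norm_orthant[OF \<open>t \<in> orthant\<close>]
    by (simp add: l1norm_def less_eq_vec_def sum_subtractf)
qed

lemma of_int_abs_diff_divide:
  "q > 0 \<Longrightarrow> real_of_int \<bar>x - y\<bar> / q = \<bar>real_of_int x / q - real_of_int y / q\<bar>"
  by (simp flip: diff_divide_distrib)

locale char_arrangement = arrangement l U V
  for l :: "'n::finite \<Rightarrow> 'k::field poly poly" and U V :: "'k poly poly" +
  assumes char: "prime CHAR('k)" and coprime_lines: "i \<noteq> j \<Longrightarrow> coprime (l i) (l j)"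
begin

text \<open>The exponent vector \<open>a\<close> at Frobenius level \<open>e\<close>, as the point \<open>a/q\<close> of the orthant with
  \<open>q = p\<^sup>e\<close>. These points are dense, so continuous functions can be compared on them.\<close>

definition point :: "nat \<Rightarrow> ('n \<Rightarrow> nat) \<Rightarrow> real ^ 'n" where
  "point e a = (\<chi> i. real (a i) / real (CHAR('k) ^ e))"

definition level_gap :: "nat \<Rightarrow> ('n \<Rightarrow> nat) \<Rightarrow> int" where
  "level_gap e a = syzygy_gap (U ^ (CHAR('k) ^ e)) (V ^ (CHAR('k) ^ e)) (form_power l a)"

definition grid :: "(real ^ 'n) set" where
  "grid = {point e a |e a. True}"

definition d :: real where "d = real_of_int koszul_degree"

lemma q_pos: "real (CHAR('k) ^ e) > 0"
  using prime_gt_0_nat[OF char] by simp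

lemma level_gap_gap: "level_gap e a = arrangement.gap l (U ^ (CHAR('k) ^ e)) (V ^ (CHAR('k) ^ e)) a"
  unfolding level_gap_def by (rule arrangement.gap_def[OF power_arrangement, symmetric])

lemma koszul_degree_power: "arrangement.koszul_degree (U ^ n) (V ^ n) = int n * koszul_degree"
  unfolding koszul_degree_def arrangement.koszul_degree_def[OF power_arrangement]
  by (simp add: tdeg_power F_form G_form algebra_simps)

lemma level_gap_scale: "level_gap (e + k) (\<lambda>i. CHAR('k) ^ k * a i) = int (CHAR('k) ^ k) * level_gap e a"
proof -
  interpret E: arrangement l "U ^ (CHAR('k) ^ e)" "V ^ (CHAR('k) ^ e)" by (rule power_arrangement)
  show ?thesis
    using E.gap_frobenius[OF char, of k a] unfolding level_gap_gap by (simp add: power_add power_mult)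
qed

lemma point_scale: "point (e + k) (\<lambda>i. CHAR('k) ^ k * a i) = point e a"
  using q_pos[of k] by (simp add: point_def vec_eq_iff power_add)

lemma point_orthant: "point e a \<in> orthant"
  by (simp add: orthant_def point_def)

lemma l1norm_point: "l1norm (point e a) = real (\<Sum>i\<in>UNIV. a i) / real (CHAR('k) ^ e)"
  unfolding l1norm_orthant[OF point_orthant] by (simp add: point_def sum_divide_distrib)

lemma l1norm_point_diff:
  "l1norm (point e a - point e b) =
     real_of_int (\<Sum>i\<in>UNIV. \<bar>int (a i) - int (b i)\<bar>) / real (CHAR('k) ^ e)"
proof -
  have "l1norm (point e a - point e b) =
      (\<Sum>i\<in>UNIV. real_of_int \<bar>int (a i) - int (b i)\<bar> / real (CHAR('k) ^ e))"
    unfolding l1norm_def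
    by (intro sum.cong) (auto simp: point_def abs_divide simp flip: diff_divide_distrib)
  then show ?thesis by (simp add: sum_divide_distrib)
qed

text \<open>After passing to the common level \<open>e + e'\<close>, which changes neither side by Frobenius,
  this is the integral estimate. In particular the normalized gap depends on the point
  only.\<close>

lemma level_gap_lipschitz:
  "\<bar>level_gap e a / real (CHAR('k) ^ e) - level_gap e' b / real (CHAR('k) ^ e')\<bar>
     \<le> l1norm (point e a - point e' b)"
proof -
  have scale: "level_gap e a / real (CHAR('k) ^ e) =
      level_gap (e + k) (\<lambda>i. CHAR('k) ^ k * a i) / real (CHAR('k) ^ (e + k))" for e k a
    using q_pos[of k] by (simp add: level_gap_scale power_add)
  define a' where "a' = (\<lambda>i. CHAR('k) ^ e' * a i)"
  define b' where "b' = (\<lambda>i. CHAR('k) ^ e * b i)"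
  interpret E: arrangement l "U ^ (CHAR('k) ^ (e + e'))" "V ^ (CHAR('k) ^ (e + e'))"
    by (rule power_arrangement)
  have eqs: "level_gap e a / real (CHAR('k) ^ e) = level_gap (e + e') a' / real (CHAR('k) ^ (e + e'))"
    "level_gap e' b / real (CHAR('k) ^ e') = level_gap (e + e') b' / real (CHAR('k) ^ (e + e'))"
    "point e a = point (e + e') a'" "point e' b = point (e + e') b'"
    using scale[of e a e'] scale[of e' b e] point_scale[of e e' a] point_scale[of e' e b]
    by (simp_all add: a'_def b'_def add.commute)
  have "real_of_int \<bar>level_gap (e + e') a' - level_gap (e + e') b'\<bar>
      \<le> real_of_int (\<Sum>i\<in>UNIV. \<bar>int (a' i) - int (b' i)\<bar>)"
    using E.gap_lipschitz[of a' b'] unfolding level_gap_gap of_int_le_iff .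
  then have "\<bar>real_of_int (level_gap (e + e') a') - real_of_int (level_gap (e + e') b')\<bar>
      / real (CHAR('k) ^ (e + e'))
      \<le> real_of_int (\<Sum>i\<in>UNIV. \<bar>int (a' i) - int (b' i)\<bar>) / real (CHAR('k) ^ (e + e'))"
    using q_pos[of "e + e'"] by (intro divide_right_mono) auto
  then show ?thesis
    unfolding eqs l1norm_point_diff
    by (simp add: abs_divide flip: diff_divide_distrib)
qed

lemma closure_grid: "closure grid = orthant"
proof
  have "closed (\<Inter>i. {t :: real ^ 'n. 0 \<le> t $ i})"
    by (intro closed_INT ballI closed_Collect_le continuous_intros)
  moreover have "orthant = (\<Inter>i. {t :: real ^ 'n. 0 \<le> t $ i})" by (auto simp: orthant_def)
  ultimately have "closed (orthant :: (real ^ 'n) set)" by simp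
  then show "closure grid \<subseteq> orthant"
    by (intro closure_minimal) (auto simp: grid_def point_orthant)
  show "orthant \<subseteq> closure grid"
  proof
    fix t :: "real ^ 'n" assume t: "t \<in> orthant"
    show "t \<in> closure grid" unfolding closure_approachable
    proof (intro allI impI)
      fix \<epsilon> :: real assume eps: "\<epsilon> > 0"
      have "1 < real CHAR('k)" using prime_gt_1_nat[OF char] by simp
      then obtain e where e: "real CARD('n) / \<epsilon> < real CHAR('k) ^ e"
        using real_arch_pow by blast
      define q where "q = real (CHAR('k) ^ e)"
      have q: "q > 0" unfolding q_def by (rule q_pos)
      define a where "a = (\<lambda>i. nat \<lfloor>t $ i * q\<rfloor>)"
      have "\<bar>(point e a - t) $ i\<bar> \<le> 1 / q" for i
      proof -
        have ti: "t $ i * q \<ge> 0" using t q by (simp add: orthant_def)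
        have "real (a i) \<le> t $ i * q" "t $ i * q < real (a i) + 1"
          using ti unfolding a_def by linarith+
        then have "\<bar>real (a i) - t $ i * q\<bar> \<le> 1" by linarith
        moreover have "(point e a - t) $ i = (real (a i) - t $ i * q) / q"
          using q by (simp add: point_def q_def field_simps)
        ultimately show ?thesis using q by (simp add: abs_divide divide_right_mono)
      qed
      then have "l1norm (point e a - t) \<le> real CARD('n) * (1 / q)"
        unfolding l1norm_def using sum_bounded_above[of UNIV] by (metis (mono_tags, lifting))
      also have "\<dots> < \<epsilon>" using e eps q by (simp add: q_def field_simps)
      finally have "norm (point e a - t) < \<epsilon>" using norm_le_l1norm[of "point e a - t"] by linarith
      then show "\<exists>y\<in>grid. dist y t < \<epsilon>" by (auto simp: grid_def dist_norm)
    qed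
  qed
qed

lemma orthant_le_by_density:
  fixes f g :: "real ^ 'n \<Rightarrow> real"
  assumes "continuous_on orthant f" "continuous_on orthant g"
    and "\<And>e a. f (point e a) \<le> g (point e a)" and "t \<in> orthant"
  shows "f t \<le> g t"
proof -
  have "f t - g t \<le> 0"
  proof (rule continuous_le_on_closure[where f = "\<lambda>t. f t - g t" and x = t and S = grid])
    show "continuous_on (closure grid) (\<lambda>t. f t - g t)"
      unfolding closure_grid by (intro continuous_on_diff assms)
    show "t \<in> closure grid" unfolding closure_grid by fact
    show "f s - g s \<le> 0" if "s \<in> grid" for s using that assms(3) by (auto simp: grid_def)
  qed
  then show ?thesis by simp
qed

text \<open>The normalized gap is Lipschitz on a dense subset of the orthant, hence extends
  continuously.\<close>

lemma Delta_exists: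
  "\<exists>D :: real ^ 'n \<Rightarrow> real. continuous_on orthant D \<and>
     (\<forall>e a. D (point e a) = level_gap e a / real (CHAR('k) ^ e))"
proof -
  define D0 where
    "D0 = (\<lambda>s. SOME v. \<exists>e a. s = point e a \<and> v = level_gap e a / real (CHAR('k) ^ e))"
  have D0: "D0 (point e a) = level_gap e a / real (CHAR('k) ^ e)" for e a
  proof -
    have "\<exists>e' a'. point e a = point e' a' \<and> D0 (point e a) = level_gap e' a' / real (CHAR('k) ^ e')"
      unfolding D0_def by (rule someI_ex) blast
    then obtain e' a' where *: "point e a = point e' a'"
      "D0 (point e a) = level_gap e' a' / real (CHAR('k) ^ e')" by blast
    have "l1norm (point e a - point e' a') = 0" unfolding *(1) by (simp add: l1norm_def)
    then show ?thesis using level_gap_lipschitz[of e a e' a'] *(2) by simp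
  qed
  have "uniformly_continuous_on grid D0"
    unfolding uniformly_continuous_on_def
  proof (intro allI impI)
    fix \<epsilon> :: real assume eps: "\<epsilon> > 0"
    show "\<exists>\<delta>>0. \<forall>x\<in>grid. \<forall>x'\<in>grid. dist x' x < \<delta> \<longrightarrow> dist (D0 x') (D0 x) < \<epsilon>"
    proof (intro exI[of _ "\<epsilon> / real CARD('n)"] conjI ballI impI)
      show "\<epsilon> / real CARD('n) > 0" using eps by simp
      fix x x' assume x: "x \<in> grid" "x' \<in> grid" and dist: "dist x' x < \<epsilon> / real CARD('n)"
      obtain e a e' a' where xx: "x = point e a" "x' = point e' a'" using x by (auto simp: grid_def)
      have "dist (D0 x') (D0 x) \<le> l1norm (x' - x)"
        unfolding xx D0 dist_real_def by (rule level_gap_lipschitz)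
      also have "\<dots> \<le> real CARD('n) * norm (x' - x)" by (rule l1norm_le_norm)
      also have "\<dots> < \<epsilon>" using dist by (simp add: dist_norm field_simps)
      finally show "dist (D0 x') (D0 x) < \<epsilon>" .
    qed
  qed
  then obtain g where g: "uniformly_continuous_on (closure grid) g"
    and ext: "\<And>x. x \<in> grid \<Longrightarrow> D0 x = g x"
    by (rule uniformly_continuous_on_extension_on_closure) (rule that, assumption, simp)
  have "continuous_on orthant g"
    using uniformly_continuous_imp_continuous[OF g] by (simp add: closure_grid)
  moreover have "g (point e a) = level_gap e a / real (CHAR('k) ^ e)" for e a
  proof -
    have "point e a \<in> grid" by (auto simp: grid_def)
    then show ?thesis using ext D0 by metis
  qed
  ultimately show ?thesis by blast
qed

abbreviation D :: "real ^ 'n \<Rightarrow> real" where "D \<equiv> Delta l U V"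

lemma Delta_spec:
  shows Delta_continuous: "continuous_on orthant D"
    and Delta_point: "D (point e a) = level_gap e a / real (CHAR('k) ^ e)"
proof -
  have "continuous_on orthant D \<and> (\<forall>e a. D (point e a) = level_gap e a / real (CHAR('k) ^ e))"
    unfolding Delta_def Let_def point_def level_gap_def
    by (rule someI_ex[OF Delta_exists[unfolded point_def level_gap_def]])
  then show "continuous_on orthant D" "D (point e a) = level_gap e a / real (CHAR('k) ^ e)" by auto
qed

lemma Delta_lipschitz:
  assumes "s \<in> orthant" "t \<in> orthant" shows "D s - D t \<le> l1norm (s - t)"
proof -
  have grid: "D (point e a) - D t \<le> l1norm (point e a - t)" for e a
  proof (rule orthant_le_by_density[where f = "\<lambda>t. D (point e a) - D t"
        and g = "\<lambda>t. l1norm (point e a - t)", OF _ _ _ assms(2)])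
    show "D (point e a) - D (point e' b) \<le> l1norm (point e a - point e' b)" for e' b
      using level_gap_lipschitz[of e a e' b] unfolding Delta_point by linarith
  qed (intro continuous_intros Delta_continuous)+
  show ?thesis
    by (rule orthant_le_by_density[where f = "\<lambda>s. D s - D t" and g = "\<lambda>s. l1norm (s - t)",
        OF _ _ grid assms(1)]) (intro continuous_intros Delta_continuous)+
qed

lemma point_koszul_degree:
  "real_of_int (int (CHAR('k) ^ e) * koszul_degree) / real (CHAR('k) ^ e) = d"
  using q_pos[of e] by (simp add: d_def)

lemma Delta_nonneg: "t \<in> orthant \<Longrightarrow> D t \<ge> 0"
proof (rule orthant_le_by_density[where f = "\<lambda>t. 0"])
  fix e a
  interpret E: arrangement l "U ^ (CHAR('k) ^ e)" "V ^ (CHAR('k) ^ e)" by (rule power_arrangement)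
  show "0 \<le> D (point e a)" using E.gap_nonneg[of a] unfolding Delta_point level_gap_gap by simp
qed (intro continuous_intros Delta_continuous)+

text \<open>With \<open>Delta_le\<close>: \<open>\<Delta>(t) = \<parallel>t\<parallel> - d\<close> on and above the hyperplane \<open>\<parallel>t\<parallel> = d\<close>.\<close>

lemma Delta_ge: "t \<in> orthant \<Longrightarrow> D t \<ge> l1norm t - d"
proof (rule orthant_le_by_density[where f = "\<lambda>t. l1norm t - d"])
  fix e a
  interpret E: arrangement l "U ^ (CHAR('k) ^ e)" "V ^ (CHAR('k) ^ e)" by (rule power_arrangement)
  have "int (\<Sum>i\<in>UNIV. a i) - int (CHAR('k) ^ e) * koszul_degree \<le> level_gap e a"
    using E.gap_ge[of a] unfolding level_gap_gap koszul_degree_power .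
  then have "real_of_int (int (\<Sum>i\<in>UNIV. a i) - int (CHAR('k) ^ e) * koszul_degree) / real (CHAR('k) ^ e)
      \<le> real_of_int (level_gap e a) / real (CHAR('k) ^ e)"
    using q_pos[of e] by (intro divide_right_mono) (auto simp only: of_int_le_iff)
  then show "l1norm (point e a) - d \<le> D (point e a)"
    unfolding Delta_point l1norm_point point_koszul_degree[of e, symmetric] by (simp add: diff_divide_distrib)
qed (intro continuous_intros Delta_continuous)+

lemma Delta_le: "t \<in> orthant \<Longrightarrow> D t \<le> \<bar>d - l1norm t\<bar>"
proof (rule orthant_le_by_density[where g = "\<lambda>t. \<bar>d - l1norm t\<bar>"])
  fix e a
  interpret E: arrangement l "U ^ (CHAR('k) ^ e)" "V ^ (CHAR('k) ^ e)" by (rule power_arrangement)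
  have "level_gap e a \<le> \<bar>int (CHAR('k) ^ e) * koszul_degree - int (\<Sum>i\<in>UNIV. a i)\<bar>"
    using E.gap_le[of a] unfolding level_gap_gap koszul_degree_power .
  then have "real_of_int (level_gap e a) / real (CHAR('k) ^ e)
      \<le> real_of_int \<bar>int (CHAR('k) ^ e) * koszul_degree - int (\<Sum>i\<in>UNIV. a i)\<bar> / real (CHAR('k) ^ e)"
    using q_pos[of e] by (intro divide_right_mono) (auto simp only: of_int_le_iff)
  also have "\<dots> = \<bar>d - l1norm (point e a)\<bar>"
    unfolding of_int_abs_diff_divide[OF q_pos] point_koszul_degree l1norm_point by simp
  finally show "D (point e a) \<le> \<bar>d - l1norm (point e a)\<bar>" unfolding Delta_point .
qed (intro continuous_intros Delta_continuous)+

text \<open>The right-hand side is continuous and, by the colength formula, has the values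
  prescribed for \<open>\<Phi>\<close>. So \<open>\<Phi>\<close> exists and, by density, equals it.\<close>

lemma Phi_eq:
  assumes "t \<in> orthant"
  shows "Phi l U V t = real (tdeg U * tdeg V) + ((D t)\<^sup>2 - (d - l1norm t)\<^sup>2) / 4"
proof -
  define \<phi> where "\<phi> = (\<lambda>t. real (tdeg U * tdeg V) + ((D t)\<^sup>2 - (d - l1norm t)\<^sup>2) / 4)"
  let ?v = "\<lambda>e a. real (ideal_deg (ideal_gen {U ^ (CHAR('k) ^ e), V ^ (CHAR('k) ^ e), form_power l a}))
    / (real (CHAR('k) ^ e))\<^sup>2"
  have cont: "continuous_on orthant \<phi>"
    unfolding \<phi>_def by (intro continuous_intros Delta_continuous) auto
  have val: "\<phi> (point e a) = ?v e a" for e a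
  proof -
    define q where "q = real (CHAR('k) ^ e)"
    define s where "s = real (\<Sum>i\<in>UNIV. a i)"
    have q: "q > 0" unfolding q_def by (rule q_pos)
    interpret E: arrangement l "U ^ (CHAR('k) ^ e)" "V ^ (CHAR('k) ^ e)" by (rule power_arrangement)
    define N where "N = ideal_deg (ideal_gen {U ^ (CHAR('k) ^ e), V ^ (CHAR('k) ^ e), form_power l a})"
    have "4 * int N = 4 * (int (CHAR('k) ^ e * tdeg U) * int (CHAR('k) ^ e * tdeg V))
        + (level_gap e a)\<^sup>2 - (int (CHAR('k) ^ e) * koszul_degree - int (\<Sum>i\<in>UNIV. a i))\<^sup>2"
      using E.colength_gap[of a]
      unfolding N_def level_gap_gap koszul_degree_power tdeg_power[OF F_form] tdeg_power[OF G_form] .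
    then have "real_of_int (4 * int N) = real_of_int (4 * (int (CHAR('k) ^ e * tdeg U)
        * int (CHAR('k) ^ e * tdeg V)) + (level_gap e a)\<^sup>2
        - (int (CHAR('k) ^ e) * koszul_degree - int (\<Sum>i\<in>UNIV. a i))\<^sup>2)" by (simp only:)
    then have "4 * real N = 4 * (q * real (tdeg U) * (q * real (tdeg V)))
        + (real_of_int (level_gap e a))\<^sup>2 - (q * d - s)\<^sup>2"
      by (simp add: q_def s_def d_def)
    moreover have "n = x + (y - z) / 4" if "4 * n = 4 * x + y - z" for n x y z :: real
      using that by (simp add: field_simps)
    ultimately have N: "real N = q * real (tdeg U) * (q * real (tdeg V))
        + ((real_of_int (level_gap e a))\<^sup>2 - (q * d - s)\<^sup>2) / 4" by blast
    show ?thesis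
      unfolding \<phi>_def Delta_point l1norm_point N_def[symmetric] q_def[symmetric] s_def[symmetric] N
      using q by (simp add: field_simps power2_eq_square)
  qed
  have ex: "\<exists>P. continuous_on orthant P \<and> (\<forall>e a. P (point e a) = ?v e a)"
    using cont val by blast
  have "continuous_on orthant (Phi l U V) \<and> (\<forall>e a. Phi l U V (point e a) = ?v e a)"
    unfolding Phi_def Let_def point_def by (rule someI_ex[OF ex[unfolded point_def]])
  then have "Phi l U V t \<le> \<phi> t" "\<phi> t \<le> Phi l U V t"
    using orthant_le_by_density[OF _ cont _ assms, of "Phi l U V"]
      orthant_le_by_density[OF cont _ _ assms, of "Phi l U V"] val by auto
  then show ?thesis unfolding \<phi>_def by simp
qed

text \<open>By Bezout's theorem the constant \<open>deg \<langle>U, V\<rangle>\<close> cancels in the formula for \<open>\<Phi>\<close>.\<close>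

lemma upper_region_iff: "t \<in> upper_region l U V \<longleftrightarrow> t \<in> orthant \<and> D t = \<bar>d - l1norm t\<bar>"
proof -
  have "(D t)\<^sup>2 = (d - l1norm t)\<^sup>2 \<longleftrightarrow> D t = \<bar>d - l1norm t\<bar>" if "t \<in> orthant"
    using Delta_nonneg[OF that] by (metis abs_of_nonneg power2_abs power2_eq_iff_nonneg abs_ge_zero)
  then show ?thesis
    unfolding upper_region_def ideal_deg_pair by (auto simp: Phi_eq)
qed

text \<open>Going up from \<open>s\<close>, the function \<open>\<Delta>\<close> cannot fall faster than its upper bound \<open>d - \<parallel>t\<parallel>\<close>
  does.\<close>

lemma upper_region_up:
  assumes "s \<in> upper_region l U V" "s \<le> t" "l1norm t \<le> d"
  shows "t \<in> upper_region l U V"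
proof -
  have s: "s \<in> orthant" "D s = \<bar>d - l1norm s\<bar>" using assms(1) by (auto simp: upper_region_iff)
  have t: "t \<in> orthant"
    using s(1) assms(2) by (auto simp: orthant_def less_eq_vec_def intro: order_trans)
  have "D s - D t \<le> l1norm t - l1norm s"
    using Delta_lipschitz[OF s(1) t] l1norm_diff_of_le[OF s(1) assms(2)] l1norm_minus_commute[of s t]
    by simp
  moreover have "D t \<le> \<bar>d - l1norm t\<bar>" using Delta_le[OF t] .
  ultimately show ?thesis using s(2) t assms(3) by (auto simp: upper_region_iff)
qed

lemma upper_region_boundary: "t \<in> orthant \<Longrightarrow> d \<le> l1norm t \<Longrightarrow> t \<in> upper_region l U V"
  using Delta_ge[of t] Delta_le[of t] by (auto simp: upper_region_iff)

section \<open>Critical points below a grid point of the upper region\<close>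

text \<open>A point of the upper region such that a cone of slope one with tip there, reflected
  where it would become negative, bounds \<open>\<Delta>\<close> on the whole orthant. This is stronger than
  being critical, and it is what the minimal exponents provide; the global bound replaces
  any analysis of the shape of the upper region.\<close>

definition apex :: "real ^ 'n \<Rightarrow> bool" where
  "apex c \<longleftrightarrow> c \<in> upper_region l U V \<and> l1norm c < d \<and>
     (\<forall>s\<in>orthant. D s \<le> \<bar>d - l1norm c - l1norm (s - c)\<bar>)"

text \<open>In terms of exponents \<open>a/q\<close> lies in the upper region below \<open>\<parallel>t\<parallel> = d\<close> if and only if
  \<open>l\<^sup>a \<in> \<langle>U\<^sup>q, V\<^sup>q\<rangle>\<close>. A minimal exponent \<open>b \<le> a\<close> in the ideal gives the apex \<open>b/q\<close>, as the
  estimate around \<open>b\<close> holds on the grid and passes to the orthant by density.\<close>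

lemma exists_apex:
  assumes up: "point e a \<in> upper_region l U V" and small: "l1norm (point e a) < d"
  shows "\<exists>b. point e b \<le> point e a \<and> apex (point e b)"
proof -
  define q where "q = real (CHAR('k) ^ e)"
  have q: "q > 0" unfolding q_def by (rule q_pos)
  interpret E: arrangement l "U ^ (CHAR('k) ^ e)" "V ^ (CHAR('k) ^ e)" by (rule power_arrangement)
  have E_koszul_degree: "real_of_int E.koszul_degree = q * d" by (simp add: koszul_degree_power q_def d_def)
  have E_gap: "real_of_int (E.gap c) = q * D (point e c)" for c
    using q by (simp add: Delta_point level_gap_gap q_def)
  have E_sum: "real_of_int (int (\<Sum>i\<in>UNIV. c i)) = q * l1norm (point e c)" for c :: "'n \<Rightarrow> nat"
    using q by (simp add: l1norm_point q_def)
  have "D (point e a) = d - l1norm (point e a)" using up small by (auto simp: upper_region_iff)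
  then have "real_of_int (E.gap a) = real_of_int (E.koszul_degree - int (\<Sum>i\<in>UNIV. a i))"
    unfolding of_int_diff E_gap E_koszul_degree E_sum by (simp add: right_diff_distrib)
  then have gap: "E.gap a = E.koszul_degree - int (\<Sum>i\<in>UNIV. a i)" by (simp only: of_int_eq_iff)
  have "real_of_int (int (\<Sum>i\<in>UNIV. a i)) < real_of_int E.koszul_degree"
    unfolding E_koszul_degree E_sum using small q by simp
  then have "int (\<Sum>i\<in>UNIV. a i) < E.koszul_degree" by (simp only: of_int_less_iff)
  from E.exponent_in_ideal[OF gap this] obtain b A B where b: "\<And>i. b i \<le> a i"
    and eq: "form_power l b = A * U ^ (CHAR('k) ^ e) + B * V ^ (CHAR('k) ^ e)"
    and hom: "homogeneous (int (\<Sum>i\<in>UNIV. b i) - int (tdeg (U ^ (CHAR('k) ^ e)))) A"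
    and AB: "\<And>i. b i > 0 \<Longrightarrow> \<not> (l i dvd A \<and> l i dvd B)"
    by (rule E.minimal_exponent) (rule that; assumption?)
  let ?c = "point e b"
  have le: "?c \<le> point e a"
    using b q by (simp add: less_eq_vec_def point_def divide_right_mono)
  have norm_le: "l1norm ?c \<le> l1norm (point e a)"
    using l1norm_diff_of_le[OF point_orthant le] l1norm_nonneg[of "point e a - ?c"] by simp
  have "form_power l b \<in> ideal_gen {U ^ (CHAR('k) ^ e), V ^ (CHAR('k) ^ e)}"
    using eq unfolding ideal_gen_pair by blast
  then have "E.koszul_degree - int (\<Sum>i\<in>UNIV. b i) \<le> E.gap b" by (rule E.gap_of_exponent_in_ideal)
  then have "real_of_int (E.koszul_degree - int (\<Sum>i\<in>UNIV. b i)) \<le> real_of_int (E.gap b)"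
    by (simp only: of_int_le_iff)
  then have "q * (d - l1norm ?c) \<le> q * D ?c"
    unfolding of_int_diff E_gap E_koszul_degree E_sum by (simp add: right_diff_distrib)
  then have "d - l1norm ?c \<le> D ?c" using q by simp
  then have upper: "?c \<in> upper_region l U V"
    using Delta_le[OF point_orthant[of e b]] norm_le small by (auto simp: upper_region_iff point_orthant)
  have "D s \<le> \<bar>d - l1norm ?c - l1norm (s - ?c)\<bar>" if "s \<in> orthant" for s
  proof (rule orthant_le_by_density[where f = D
        and g = "\<lambda>s. \<bar>d - l1norm ?c - l1norm (s - ?c)\<bar>", OF _ _ _ that])
    fix k and x :: "'n \<Rightarrow> nat"
    define Q where "Q = CHAR('k) ^ k"
    define y where "y = (\<lambda>i. CHAR('k) ^ e * x i)"
    have pq: "real (CHAR('k) ^ (e + k)) = real Q * q" by (simp add: Q_def q_def power_add)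
    have Q: "real Q > 0" unfolding Q_def by (rule q_pos)
    have y: "point k x = point (e + k) y"
      using point_scale[of k e x] by (simp add: y_def add.commute)
    have c: "?c = point (e + k) (\<lambda>i. Q * b i)" using point_scale[of e k b] by (simp add: Q_def)
    have "level_gap (e + k) y \<le> \<bar>int Q * (E.koszul_degree - int (\<Sum>i\<in>UNIV. b i))
        - (\<Sum>i\<in>UNIV. \<bar>int (y i) - int (Q * b i)\<bar>)\<bar>"
      using E.gap_le_near_minimal_exponent[OF char coprime_lines eq hom AB Q_def, of y]
      unfolding level_gap_gap by (simp add: Q_def power_add power_mult)
    then have "real_of_int (level_gap (e + k) y) \<le> real_of_int \<bar>int Q * (E.koszul_degree - int (\<Sum>i\<in>UNIV. b i))
        - (\<Sum>i\<in>UNIV. \<bar>int (y i) - int (Q * b i)\<bar>)\<bar>" by (simp only: of_int_le_iff)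
    also have "\<dots> = \<bar>real Q * (real_of_int E.koszul_degree - real_of_int (int (\<Sum>i\<in>UNIV. b i)))
        - real_of_int (\<Sum>i\<in>UNIV. \<bar>int (y i) - int (Q * b i)\<bar>)\<bar>"
      by (simp only: of_int_abs of_int_diff of_int_mult of_int_of_nat_eq)
    also have "real_of_int (\<Sum>i\<in>UNIV. \<bar>int (y i) - int (Q * b i)\<bar>) =
        real Q * q * l1norm (point k x - ?c)"
      unfolding y c l1norm_point_diff pq using Q q by simp
    also have "real Q * (real_of_int E.koszul_degree - real_of_int (int (\<Sum>i\<in>UNIV. b i)))
        = real Q * q * (d - l1norm ?c)"
      unfolding E_koszul_degree E_sum by (simp add: algebra_simps)
    also have "\<bar>real Q * q * (d - l1norm ?c) - real Q * q * l1norm (point k x - ?c)\<bar>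
        = real Q * q * \<bar>d - l1norm ?c - l1norm (point k x - ?c)\<bar>"
      using Q q by (simp add: abs_mult flip: right_diff_distrib)
    finally have "real_of_int (level_gap (e + k) y) / (real Q * q)
        \<le> \<bar>d - l1norm ?c - l1norm (point k x - ?c)\<bar>"
      using Q q by (simp add: divide_le_eq mult.commute)
    then show "D (point k x) \<le> \<bar>d - l1norm ?c - l1norm (point k x - ?c)\<bar>"
      unfolding y Delta_point pq .
  qed (intro continuous_intros Delta_continuous)+
  then have "apex ?c" using upper norm_le small by (auto simp: apex_def)
  then show ?thesis using le by blast
qed

text \<open>Write \<open>\<sigma>\<close> and \<open>\<rho>\<close> for the total amounts by which \<open>s\<close> exceeds \<open>c\<close> and falls below \<open>c\<close>.
  The cone at \<open>c\<close> bounds \<open>\<Delta>(s)\<close> by \<open>\<bar>d - \<parallel>c\<parallel> - \<sigma> - \<rho>\<bar>\<close>, while membership in the upper region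
  requires \<open>d - \<parallel>c\<parallel> - \<sigma> + \<rho>\<close>. As \<open>\<sigma> < d - \<parallel>c\<parallel>\<close>, this forces \<open>\<rho> = 0\<close>. So below \<open>w\<close> the upper
  region is the part above \<open>c\<close>.\<close>

lemma apex_le_upper:
  assumes c: "apex c" "c \<le> w" and w: "l1norm w < d" and s: "s \<in> upper_region l U V" "s \<le> w"
  shows "c \<le> s"
proof (rule ccontr)
  assume "\<not> c \<le> s"
  then obtain i where i: "s $ i < c $ i" by (auto simp: less_eq_vec_def not_le)
  have orth: "c \<in> orthant" "s \<in> orthant" "D s = \<bar>d - l1norm s\<bar>"
    using c s by (auto simp: apex_def upper_region_iff)
  have worth: "w \<in> orthant"
    using orth(1) c(2) by (auto simp: orthant_def less_eq_vec_def intro: order_trans)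
  define \<sigma> where "\<sigma> = (\<Sum>i\<in>UNIV. max 0 (s $ i - c $ i))"
  define \<rho> where "\<rho> = (\<Sum>i\<in>UNIV. max 0 (c $ i - s $ i))"
  have "0 < max 0 (c $ i - s $ i)" using i by simp
  also have "\<dots> \<le> \<rho>" unfolding \<rho>_def by (intro member_le_sum) auto
  finally have rho: "\<rho> > 0" .
  have dist: "l1norm (s - c) = \<sigma> + \<rho>"
    unfolding l1norm_def \<sigma>_def \<rho>_def sum.distrib[symmetric] by (intro sum.cong) auto
  have norm: "l1norm s - l1norm c = \<sigma> - \<rho>"
    unfolding l1norm_orthant[OF orth(1)] l1norm_orthant[OF orth(2)] \<sigma>_def \<rho>_def
      sum_subtractf[symmetric] by (intro sum.cong) auto
  have "\<sigma> \<le> (\<Sum>i\<in>UNIV. w $ i - c $ i)"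
    unfolding \<sigma>_def using c(2) s(2) by (intro sum_mono) (auto simp: less_eq_vec_def)
  also have "\<dots> = l1norm w - l1norm c"
    by (simp add: l1norm_orthant[OF orth(1)] l1norm_orthant[OF worth] sum_subtractf)
  finally have sigma: "\<sigma> < d - l1norm c" using w by simp
  have "\<bar>d - l1norm s\<bar> \<le> \<bar>d - l1norm c - (\<sigma> + \<rho>)\<bar>"
    using c(1) orth(2,3) dist unfolding apex_def by fastforce
  then show False using norm rho sigma by linarith
qed

text \<open>Within distance \<open>d - \<parallel>c\<parallel>\<close> of \<open>c\<close> the cone stays below its value \<open>d - \<parallel>c\<parallel>\<close> at the tip.
  The factor \<open>CARD('n)\<close> converts the Euclidean ball into the distance used there.\<close>

lemma apex_critical:
  assumes c: "apex c" shows "critical_point l U V c"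
proof -
  have up: "c \<in> orthant" "D c = d - l1norm c" and lt: "l1norm c < d"
    using c by (auto simp: apex_def upper_region_iff)
  have deg: "d = real (tdeg (U * V))"
    by (simp add: d_def koszul_degree_def tdeg_mult F_form G_form)
  define \<epsilon> where "\<epsilon> = (d - l1norm c) / real CARD('n)"
  have max: "D s \<le> D c" if s: "s \<in> orthant \<inter> ball c \<epsilon>" for s
  proof -
    have "l1norm (s - c) \<le> real CARD('n) * norm (s - c)" by (rule l1norm_le_norm)
    also have "\<dots> < d - l1norm c"
      using s by (simp add: \<epsilon>_def dist_norm norm_minus_commute field_simps)
    finally have "\<bar>d - l1norm c - l1norm (s - c)\<bar> \<le> d - l1norm c"
      using l1norm_nonneg[of "s - c"] by simp
    moreover have "D s \<le> \<bar>d - l1norm c - l1norm (s - c)\<bar>" using c s by (simp add: apex_def)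
    ultimately show ?thesis using up(2) by linarith
  qed
  have "\<epsilon> > 0" using lt by (simp add: \<epsilon>_def)
  then show ?thesis
    unfolding critical_point_def using up max deg by (intro conjI exI[of _ \<epsilon>] ballI) simp_all
qed

text \<open>A critical point below \<open>w\<close> lies in the upper region, hence above the apex. If it were
  a different point, moving down from it would increase \<open>\<Delta>\<close>.\<close>

lemma critical_eq_apex:
  assumes c: "apex c" "c \<le> w" and w: "l1norm w < d"
    and c': "critical_point l U V c'" "c' \<le> w"
  shows "c' = c"
proof -
  have deg: "d = real (tdeg (U * V))"
    by (simp add: d_def koszul_degree_def tdeg_mult F_form G_form)
  have orth: "c' \<in> orthant" and D: "D c' = d - l1norm c'"
    using c' by (auto simp: critical_point_def deg)
  obtain \<epsilon> where eps: "\<epsilon> > 0" "\<And>s. s \<in> orthant \<inter> ball c' \<epsilon> \<Longrightarrow> D s \<le> D c'"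
    using c' unfolding critical_point_def by blast
  have small: "l1norm c' < d"
    using l1norm_diff_of_le[OF orth c'(2)] l1norm_nonneg[of "w - c'"] w by simp
  have up: "c' \<in> upper_region l U V" using orth D small by (simp add: upper_region_iff)
  have le: "c \<le> c'" by (rule apex_le_upper[OF c w up c'(2)])
  show ?thesis
  proof (rule ccontr)
    assume "c' \<noteq> c"
    then obtain i where i: "c $ i < c' $ i"
      using le by (metis less_eq_vec_def order_antisym not_le vec_eq_iff)
    \<comment> \<open>Moving from \<open>c'\<close> towards \<open>c\<close> stays in the upper region and increases \<open>\<Delta>\<close>.\<close>
    define \<eta> where "\<eta> = min (c' $ i - c $ i) (\<epsilon> / 2)"
    have eta: "\<eta> > 0" "\<eta> \<le> c' $ i - c $ i" "\<eta> < \<epsilon>" using i eps(1) by (auto simp: \<eta>_def)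
    define s where "s = c' - axis i \<eta>"
    have sj: "s $ j = (if j = i then c' $ i - \<eta> else c' $ j)" for j
      by (simp add: s_def axis_def)
    have c_s: "c \<le> s" using le eta by (auto simp: less_eq_vec_def sj)
    have s_c': "s \<le> c'" using eta by (auto simp: less_eq_vec_def sj)
    have s: "s \<in> orthant"
      using c c_s by (auto simp: apex_def upper_region_iff orthant_def less_eq_vec_def intro: order_trans)
    have eta_eq: "l1norm (c' - s) = \<eta>"
      using eta by (simp add: s_def l1norm_def axis_def)
    then have norm: "l1norm s = l1norm c' - \<eta>" using l1norm_diff_of_le[OF s s_c'] by simp
    have "c \<in> upper_region l U V" using c by (simp add: apex_def)
    then have "s \<in> upper_region l U V" using upper_region_up[OF _ c_s] norm small eta by simp
    then have "D s = d - l1norm c' + \<eta>" using norm small eta by (simp add: upper_region_iff)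
    moreover have "dist c' s < \<epsilon>" using eta norm_le_l1norm[of "c' - s"] by (simp add: eta_eq dist_norm)
    then have "D s \<le> D c'" using eps(2) s by simp
    ultimately show False using D eta by simp
  qed
qed

section \<open>The threshold\<close>

text \<open>Here \<open>\<Delta>(0) = \<bar>deg U - deg V\<bar>\<close>, which is less than \<open>deg (U V)\<close>.\<close>

lemma zero_not_upper:
  assumes "tdeg U > 0" "tdeg V > 0" shows "0 \<notin> upper_region l U V"
proof -
  have zero: "(0 :: real ^ 'n) = point 0 (\<lambda>i. 0)" by (simp add: point_def vec_eq_iff)
  have "syzygy_degrees (int (tdeg U)) (int (tdeg V)) U V (form_power l (\<lambda>i. 0))"
    using syzygy_degrees_1[OF F_form G_form] by simp
  from syzygy_degrees_gap(1)[OF this] have "level_gap 0 (\<lambda>i. 0) = \<bar>int (tdeg U) - int (tdeg V)\<bar>"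
    by (simp add: level_gap_def gap_def)
  then have "D 0 = \<bar>real (tdeg U) - real (tdeg V)\<bar>" unfolding zero Delta_point by simp
  moreover have "\<bar>d - l1norm (0 :: real ^ 'n)\<bar> = real (tdeg U) + real (tdeg V)"
    by (simp add: d_def koszul_degree_def l1norm_def)
  moreover have "\<bar>real (tdeg U) - real (tdeg V)\<bar> \<noteq> real (tdeg U) + real (tdeg V)"
    using assms by linarith
  ultimately show ?thesis by (simp add: upper_region_iff)
qed

text \<open>A multiple \<open>x t\<close> below \<open>\<parallel>t\<parallel> = d\<close> lies in the upper region if and only if \<open>c \<le> x t\<close>.\<close>

lemma F_threshold_apex:
  fixes c t :: "real ^ 'n"
  assumes c: "apex c" and pos: "\<And>i. t $ i > 0" and lam: "l1norm (lam *\<^sub>R t) = d"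
    and lt: "\<And>i. c $ i < lam * t $ i" and deg: "tdeg U > 0" "tdeg V > 0"
  shows "F_threshold l U V t = (MAX i. c $ i / t $ i)" "(MAX i. c $ i / t $ i) < lam"
proof -
  define r where "r = (MAX i. c $ i / t $ i)"
  have "r < lam"
    unfolding r_def using lt pos by (subst Max_less_iff) (auto simp: divide_less_eq)
  then show "(MAX i. c $ i / t $ i) < lam" by (simp add: r_def)
  have r_ge: "c $ i / t $ i \<le> r" for i unfolding r_def by (intro Max_ge) auto
  have c_up: "c \<in> upper_region l U V" and c_orth: "c \<in> orthant"
    using c by (auto simp: apex_def upper_region_iff)
  have c_le: "c \<le> r *\<^sub>R t"
    using r_ge pos by (simp add: less_eq_vec_def pos_divide_le_eq)
  have "c \<noteq> 0" using zero_not_upper[OF deg] c_up by blast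
  then obtain j where "c $ j \<noteq> 0" by (auto simp: vec_eq_iff)
  then have "c $ j > 0" using c_orth by (auto simp: orthant_def order.order_iff_strict)
  then have "0 < c $ j / t $ j" using pos by simp
  then have r0: "0 < r" using r_ge[of j] by linarith
  have t_orth: "x *\<^sub>R t \<in> orthant" if "x \<ge> 0" for x
    using that pos by (simp add: orthant_def less_imp_le)
  have "l1norm (lam *\<^sub>R t) = lam * l1norm t" "l1norm (r *\<^sub>R t) = r * l1norm t"
    using \<open>r < lam\<close> r0 by (simp_all add: l1norm_def abs_mult sum_distrib_left)
  moreover have "l1norm t > 0"
    unfolding l1norm_def using pos by (intro sum_pos) (auto simp: less_imp_neq[THEN not_sym])
  ultimately have r_lt: "l1norm (r *\<^sub>R t) < d" using lam \<open>r < lam\<close> by (metis mult_strict_right_mono)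
  have "r *\<^sub>R t \<in> upper_region l U V"
    using upper_region_up[OF c_up c_le] r_lt by simp
  moreover have "r \<le> x" if "0 < x \<and> x *\<^sub>R t \<in> upper_region l U V" for x
  proof (rule ccontr)
    assume "\<not> r \<le> x"
    then have "x *\<^sub>R t \<le> r *\<^sub>R t" using pos by (simp add: less_eq_vec_def less_imp_le mult_right_mono)
    then have "c \<le> x *\<^sub>R t" using apex_le_upper[OF c c_le r_lt] that by blast
    then have "c $ i / t $ i \<le> x" for i
      using pos by (simp add: less_eq_vec_def pos_divide_le_eq)
    then have "r \<le> x" unfolding r_def by (subst Max_le_iff) auto
    then show False using \<open>\<not> r \<le> x\<close> by simp
  qed
  ultimately show "F_threshold l U V t = (MAX i. c $ i / t $ i)"
    unfolding F_threshold_def r_def[symmetric] using r0 by (intro Least_equality) auto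
qed

lemma truncation_point:
  fixes t :: "real ^ 'n"
  assumes "\<And>i. t $ i > 0"
  shows "truncation CHAR('k) e t = point e (\<lambda>i. nat (\<lceil>t $ i * real CHAR('k) ^ e\<rceil> - 1))"
proof -
  have "\<lceil>t $ i * real CHAR('k) ^ e\<rceil> \<ge> 1" for i
  proof -
    have "0 < t $ i * real CHAR('k) ^ e" using assms q_pos[of e] by simp
    then show ?thesis by linarith
  qed
  then show ?thesis by (simp add: truncation_def point_def vec_eq_iff of_nat_nat)
qed

lemma truncation_less: "truncation CHAR('k) e t $ i < t $ i" for t :: "real ^ 'n"
proof -
  have q: "0 < real CHAR('k) ^ e" using q_pos[of e] by simp
  have "of_int \<lceil>t $ i * real CHAR('k) ^ e\<rceil> - 1 < t $ i * real CHAR('k) ^ e" by linarith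
  then show ?thesis using q by (simp add: truncation_def divide_less_eq)
qed

lemma truncation_approx:
  fixes s t :: "real ^ 'n"
  assumes "\<And>i. s $ i < t $ i" shows "\<exists>e. s \<le> truncation CHAR('k) e t"
proof -
  define \<epsilon> where "\<epsilon> = (MIN i. t $ i - s $ i)"
  have eps: "\<epsilon> \<le> t $ i - s $ i" for i unfolding \<epsilon>_def by (intro Min_le) auto
  have "\<epsilon> > 0" unfolding \<epsilon>_def using assms by (subst Min_gr_iff) auto
  have "1 < real CHAR('k)" using prime_gt_1_nat[OF char] by simp
  then obtain e where e: "1 / \<epsilon> < real CHAR('k) ^ e" using real_arch_pow by blast
  have q: "0 < real CHAR('k) ^ e" using q_pos[of e] by simp
  have "s $ i \<le> truncation CHAR('k) e t $ i" for i
  proof -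
    have "1 \<le> \<epsilon> * real CHAR('k) ^ e" using e \<open>\<epsilon> > 0\<close> by (simp add: field_simps)
    also have "\<dots> \<le> (t $ i - s $ i) * real CHAR('k) ^ e" using eps q by (intro mult_right_mono) auto
    finally have "s $ i * real CHAR('k) ^ e \<le> t $ i * real CHAR('k) ^ e - 1"
      by (simp add: left_diff_distrib)
    also have "\<dots> \<le> of_int \<lceil>t $ i * real CHAR('k) ^ e\<rceil> - 1" by linarith
    finally show ?thesis using q by (simp add: truncation_def pos_le_divide_eq)
  qed
  then show ?thesis by (auto simp: less_eq_vec_def)
qed

text \<open>The truncations of \<open>\<lambda> t\<close> converge to \<open>\<lambda> t\<close>, so they eventually exceed any \<open>x t\<close> with
  \<open>x < \<lambda>\<close>; since the upper region is closed under going up, it would contain a truncation as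
  soon as it contains \<open>x t\<close>.\<close>

lemma F_threshold_diagonal:
  fixes t :: "real ^ 'n"
  assumes pos: "\<And>i. t $ i > 0" and lam: "lam > 0" "l1norm (lam *\<^sub>R t) = d"
    and none: "\<And>e. truncation CHAR('k) e (lam *\<^sub>R t) \<notin> upper_region l U V"
  shows "F_threshold l U V t = lam"
  unfolding F_threshold_def
proof (rule Least_equality)
  have "lam *\<^sub>R t \<in> orthant" using pos lam by (simp add: orthant_def less_imp_le)
  then show "0 < lam \<and> lam *\<^sub>R t \<in> upper_region l U V"
    using upper_region_boundary lam by simp
  fix x assume x: "0 < x \<and> x *\<^sub>R t \<in> upper_region l U V"
  show "lam \<le> x"
  proof (rule ccontr)
    assume "\<not> lam \<le> x"
    then obtain e where e: "x *\<^sub>R t \<le> truncation CHAR('k) e (lam *\<^sub>R t)"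
      using truncation_approx[of "x *\<^sub>R t" "lam *\<^sub>R t"] pos by auto
    have "truncation CHAR('k) e (lam *\<^sub>R t) \<in> orthant"
      using truncation_point[of "lam *\<^sub>R t" e] pos lam by (simp add: point_orthant)
    then have "l1norm (truncation CHAR('k) e (lam *\<^sub>R t)) \<le> l1norm (lam *\<^sub>R t)"
      unfolding l1norm_orthant[OF \<open>lam *\<^sub>R t \<in> orthant\<close>]
      by (simp only: l1norm_orthant) (intro sum_mono less_imp_le truncation_less)
    then have "truncation CHAR('k) e (lam *\<^sub>R t) \<in> upper_region l U V"
      using upper_region_up[OF _ e] x lam by simp
    then show False using none by blast
  qed
qed

end

theorem theorem5p9:
  fixes l :: "'n::finite \<Rightarrow> 'k::field poly poly"
    and U V :: "'k poly poly"
    and t :: "real ^ 'n"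
    and p :: nat
    and lam :: real
  assumes "CHAR('k) = p" and "p > 0"
    and "\<And>i. is_form (l i) \<and> tdeg (l i) = 1"
    and "\<And>i j. i \<noteq> j \<Longrightarrow> coprime (l i) (l j)"
    and "is_form U" and "tdeg U > 0"
    and "is_form V" and "tdeg V > 0"
    and "coprime U V"
    and "\<And>i. t $ i > 0"
    and "lam = real (tdeg (U * V)) / l1norm t"
  shows "(\<forall>e. truncation p e (lam *\<^sub>R t) \<in> upper_region l U V \<longrightarrow>
            (\<exists>!c. critical_point l U V c \<and> c \<le> truncation p e (lam *\<^sub>R t) \<and>
                  (\<forall>i. c $ i \<in> fractions (p ^ e))) \<and>
            (\<forall>c. critical_point l U V c \<and> c \<le> truncation p e (lam *\<^sub>R t) \<and>
                  (\<forall>i. c $ i \<in> fractions (p ^ e)) \<longrightarrow>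
               F_threshold l U V t = (MAX i. c $ i / t $ i) \<and>
               (MAX i. c $ i / t $ i) < lam))
       \<and> ((\<forall>e. truncation p e (lam *\<^sub>R t) \<notin> upper_region l U V) \<longrightarrow>
            F_threshold l U V t = lam)"
proof -
  have p: "CHAR('k) = p" by fact
  interpret char_arrangement l U V
  proof
    show "prime CHAR('k)" using assms(1,2) by (intro prime_CHAR_semidom) simp
    show "regular_pair U V" by (rule coprime_forms_regular) fact+
  qed (use assms(3,5,7) in auto, use assms(4) in blast)
  have d: "d = real (tdeg (U * V))" by (simp add: d_def koszul_degree_def tdeg_mult F_form G_form)
  have pos: "t $ i > 0" for i by fact
  have norm_pos: "l1norm t > 0"
    unfolding l1norm_def using pos by (intro sum_pos) (auto simp: less_imp_neq[THEN not_sym])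
  have "d > 0" unfolding d using assms(5-8) by (simp add: tdeg_mult)
  then have lam_pos: "lam > 0" using assms(11) norm_pos d by simp
  have lam_norm: "l1norm (lam *\<^sub>R t) = d"
  proof -
    have "l1norm (lam *\<^sub>R t) = lam * l1norm t"
      using lam_pos by (simp add: l1norm_def abs_mult sum_distrib_left)
    then show ?thesis using assms(11) norm_pos d by simp
  qed
  have lt_pos: "(lam *\<^sub>R t) $ i > 0" for i using lam_pos pos by simp
  show ?thesis
  proof (intro conjI allI impI)
    fix e assume up: "truncation p e (lam *\<^sub>R t) \<in> upper_region l U V"
    define w where "w = truncation p e (lam *\<^sub>R t)"
    obtain a where a: "w = point e a"
      using truncation_point[OF lt_pos, of e] unfolding w_def p by blast
    have w_lt: "w $ i < lam * t $ i" for i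
      using truncation_less[of e "lam *\<^sub>R t" i] unfolding w_def p by simp
    have "w \<in> orthant" by (simp add: a point_orthant)
    have "l1norm w < l1norm (lam *\<^sub>R t)"
    proof -
      have "lam *\<^sub>R t \<in> orthant" using lt_pos by (simp add: orthant_def less_imp_le)
      then show ?thesis
        unfolding l1norm_orthant[OF \<open>w \<in> orthant\<close>] using w_lt
        by (simp only: l1norm_orthant) (intro sum_strict_mono, auto)
    qed
    then have w_small: "l1norm w < d" using lam_norm by simp
    obtain b where b: "point e b \<le> w" "apex (point e b)"
      using exists_apex[of e a] up w_small unfolding w_def[symmetric] a by blast
    let ?c = "point e b"
    have frac: "?c $ i \<in> fractions (p ^ e)" for i
      unfolding fractions_def point_def p by (auto intro!: exI[of _ "int (b i)"])
    have unique: "c = ?c" if "critical_point l U V c" "c \<le> w" for c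
      by (rule critical_eq_apex[OF b(2,1) w_small that])
    have crit: "critical_point l U V ?c" by (rule apex_critical[OF b(2)])
    show "\<exists>!c. critical_point l U V c \<and> c \<le> truncation p e (lam *\<^sub>R t) \<and>
        (\<forall>i. c $ i \<in> fractions (p ^ e))"
      unfolding w_def[symmetric] using crit b(1) frac unique by (intro ex1I[of _ ?c]) blast+
    fix c assume c: "critical_point l U V c \<and> c \<le> truncation p e (lam *\<^sub>R t) \<and>
        (\<forall>i. c $ i \<in> fractions (p ^ e))"
    have "c = ?c" using unique c unfolding w_def[symmetric] by blast
    moreover have "?c $ i < lam * t $ i" for i
      using b(1) w_lt[of i] by (auto simp: less_eq_vec_def intro: le_less_trans)
    ultimately show "F_threshold l U V t = (MAX i. c $ i / t $ i)" "(MAX i. c $ i / t $ i) < lam"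
      using F_threshold_apex[OF b(2) pos lam_norm _ assms(6,8)] by blast+
  next
    assume "\<forall>e. truncation p e (lam *\<^sub>R t) \<notin> upper_region l U V"
    then show "F_threshold l U V t = lam"
      using F_threshold_diagonal[OF pos lam_pos lam_norm] p by blast
  qed
qed

end
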